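(* Let $(\Omega,\mu)$ be a probability space. A random linear operator $A:\Omega\to\mathcal{L}(L^2(S^1))$ is a Laurent random operator if and only if its matrix coefficients satisfy $$a_{i+1,j+1}(\omega)=a_{ij}(\omega)$$ for all $\omega\in\Omega$ and $i,j\in\mathbb{Z}$.
   Context: $S^1$ is the unit circle in $\mathbb{C}$ and $L^2(S^1)$ is the Hilbert space of square integrable complex-valued functions on $S^1$ with respect to Lebesgue measure. $\mathcal{L}(H)$ is the algebra of bounded linear operators on a Hilbert space $H$. A random linear operator is a map $A:\Omega\to\mathcal{L}(H)$ such that $\omega\mapsto\langle A(\omega)x,y\rangle$ is measurable for all $x,y\in H$. For $n\in\mathbb{Z}$, $e_n(z)=z^n$ on $S^1$; the matrix coefficients of $A:\Omega\to\mathcal{L}(L^2(S^1))$ are $a_{ij}(\omega)=\langle A(\omega)e_j,e_i\rangle$, $i,j\in\mathbb{Z}$. $A$ is a Laurent random operator if $A=L^\varphi$ for some $\varphi:\Omega\times S^1\to\mathbb{C}$, measurable with respect to the product measure, with $\varphi_\omega:=\varphi(\omega,\cdot)$ bounded for every $\omega\in\Omega$, where $L^\varphi_\omega f=\varphi_\omega f$ for $f\in L^2(S^1)$. *)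

theory Defs
  imports "HOL-Probability.Probability"
begin

section \<open>The space $L^2(S^1)$\<close>

text \<open>Lebesgue measure on the unit circle, on the Borel subsets of \<^term>\<open>sphere (0::complex) 1\<close>,
  normalised to total mass one so that the functions $z \mapsto z^n$ are orthonormal.\<close>

definition circle_measure :: "complex measure" where
  "circle_measure =
     distr (uniform_measure lborel {0..<2 * pi}) (restrict_space borel (sphere 0 1)) cis"

lemma space_circle_measure [simp]: "space circle_measure = sphere 0 1"
  by (simp add: circle_measure_def space_restrict_space)

lemma sets_circle_measure [measurable_cong]:
  "sets circle_measure = sets (restrict_space borel (sphere 0 1))"
  by (simp add: circle_measure_def)

lemma prob_space_circle_measure: "prob_space circle_measure"
proof -
  interpret prob_space "uniform_measure lborel {0..<2 * pi}"
    by (rule prob_space_uniform_measure) simp_all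
  have "cis \<in> borel \<rightarrow>\<^sub>M borel"
    by (intro borel_measurable_continuous_onI continuous_intros)
  then have "cis \<in> uniform_measure lborel {0..<2 * pi} \<rightarrow>\<^sub>M restrict_space borel (sphere 0 1)"
    by (intro measurable_restrict_space2) (auto simp: measurable_def)
  then show ?thesis
    unfolding circle_measure_def by (rule prob_space_distr)
qed

definition square_integrable :: "(complex \<Rightarrow> complex) \<Rightarrow> bool" where
  "square_integrable f \<longleftrightarrow>
     f \<in> borel_measurable circle_measure \<and> integrable circle_measure (\<lambda>z. (norm (f z))\<^sup>2)"

definition ae_eq :: "(complex \<Rightarrow> complex) \<Rightarrow> (complex \<Rightarrow> complex) \<Rightarrow> bool" where
  "ae_eq f g \<longleftrightarrow>
     square_integrable f \<and> square_integrable g \<and> (AE z in circle_measure. f z = g z)"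

lemma square_integrable_zero: "square_integrable (\<lambda>z. 0)"
  by (simp add: square_integrable_def)

lemma square_integrable_measurable [measurable_dest]:
  "square_integrable f \<Longrightarrow> f \<in> borel_measurable circle_measure"
  by (simp add: square_integrable_def)

lemma square_integrable_add:
  assumes "square_integrable f" "square_integrable g"
  shows "square_integrable (\<lambda>z. f z + g z)"
proof -
  note [measurable] = assms[THEN square_integrable_measurable]
  have "integrable circle_measure (\<lambda>z. 2 * (norm (f z))\<^sup>2 + 2 * (norm (g z))\<^sup>2)"
    using assms by (simp add: square_integrable_def)
  moreover have "(norm (f z + g z))\<^sup>2 \<le> 2 * (norm (f z))\<^sup>2 + 2 * (norm (g z))\<^sup>2" for z
  proof -
    have "(norm (f z + g z))\<^sup>2 \<le> (norm (f z) + norm (g z))\<^sup>2"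
      by (intro power_mono norm_triangle_ineq) simp
    also have "\<dots> \<le> 2 * (norm (f z))\<^sup>2 + 2 * (norm (g z))\<^sup>2"
      using sum_squares_bound[of "norm (f z)" "norm (g z)"] by (simp add: power2_sum)
    finally show ?thesis .
  qed
  ultimately have "integrable circle_measure (\<lambda>z. (norm (f z + g z))\<^sup>2)"
    by (elim Bochner_Integration.integrable_bound) simp_all
  then show ?thesis by (simp add: square_integrable_def)
qed

lemma square_integrable_bounded_mult:
  assumes "square_integrable f" and g: "g \<in> borel_measurable circle_measure"
    "bounded (g ` sphere 0 1)"
  shows "square_integrable (\<lambda>z. g z * f z)"
proof -
  note [measurable] = assms(1)[THEN square_integrable_measurable] g(1)
  obtain C where C: "\<And>z. z \<in> sphere 0 1 \<Longrightarrow> norm (g z) \<le> C"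
    using g(2) by (metis bounded_iff imageI)
  have "integrable circle_measure (\<lambda>z. C\<^sup>2 * (norm (f z))\<^sup>2)"
    using assms by (simp add: square_integrable_def)
  moreover have "AE z in circle_measure. norm ((norm (g z * f z))\<^sup>2) \<le> norm (C\<^sup>2 * (norm (f z))\<^sup>2)"
    using C by (intro AE_I2) (simp add: norm_mult power_mult_distrib mult_right_mono power_mono)
  ultimately have "integrable circle_measure (\<lambda>z. (norm (g z * f z))\<^sup>2)"
    by (elim Bochner_Integration.integrable_bound) simp_all
  then show ?thesis by (simp add: square_integrable_def)
qed

lemma square_integrable_scale: "square_integrable f \<Longrightarrow> square_integrable (\<lambda>z. c * f z)"
  by (rule square_integrable_bounded_mult) (auto simp: image_constant_conv)

lemma square_integrable_inner:
  assumes "square_integrable f" "square_integrable g"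
  shows "integrable circle_measure (\<lambda>z. f z * cnj (g z))"
proof -
  note [measurable] = assms[THEN square_integrable_measurable]
  have cnj: "cnj \<in> borel_measurable borel"
    by (intro borel_measurable_continuous_onI continuous_intros)
  note [measurable] = measurable_compose[OF assms(2)[THEN square_integrable_measurable] cnj]
  have "integrable circle_measure (\<lambda>z. (norm (f z))\<^sup>2 + (norm (g z))\<^sup>2)"
    using assms by (simp add: square_integrable_def)
  moreover have "norm (f z * cnj (g z)) \<le> norm ((norm (f z))\<^sup>2 + (norm (g z))\<^sup>2)" for z
  proof -
    have "0 \<le> norm (f z) * norm (g z)" by simp
    moreover have "2 * (norm (f z) * norm (g z)) \<le> (norm (f z))\<^sup>2 + (norm (g z))\<^sup>2"
      using sum_squares_bound[of "norm (f z)" "norm (g z)"] by simp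
    ultimately have "norm (f z) * norm (g z) \<le> (norm (f z))\<^sup>2 + (norm (g z))\<^sup>2"
      by linarith
    then show ?thesis
      by (simp add: norm_mult)
  qed
  ultimately show ?thesis
    by (elim Bochner_Integration.integrable_bound) (simp_all add: measurable_compose)
qed

quotient_type circle_L2 = "complex \<Rightarrow> complex" / partial: ae_eq
proof (rule part_equivpI)
  show "\<exists>f. ae_eq f f"
    using square_integrable_zero by (auto simp: ae_eq_def)
  show "symp ae_eq"
    by (auto simp: symp_def ae_eq_def)
  show "transp ae_eq"
    unfolding transp_def ae_eq_def
  proof (intro allI impI, elim conjE, intro conjI)
    fix f g h :: "complex \<Rightarrow> complex"
    assume "AE z in circle_measure. f z = g z" "AE z in circle_measure. g z = h z"
    then show "AE z in circle_measure. f z = h z" by eventually_elim simp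
  qed
qed

text \<open>The inner product is linear in the first argument.\<close>

lift_definition cinner :: "circle_L2 \<Rightarrow> circle_L2 \<Rightarrow> complex"
  is "\<lambda>f g. LINT z|circle_measure. f z * cnj (g z)"
proof -
  fix f f' g g' assume *: "ae_eq f f'" "ae_eq g g'"
  then have "AE z in circle_measure. f z = f' z" "AE z in circle_measure. g z = g' z"
    by (auto simp: ae_eq_def)
  then have "AE z in circle_measure. f z * cnj (g z) = f' z * cnj (g' z)"
    by eventually_elim simp
  then show "(LINT z|circle_measure. f z * cnj (g z)) = (LINT z|circle_measure. f' z * cnj (g' z))"
    using * by (intro integral_cong_AE)
      (simp_all add: ae_eq_def borel_measurable_integrable square_integrable_inner)
qed

lift_definition scaleC :: "complex \<Rightarrow> circle_L2 \<Rightarrow> circle_L2" is "\<lambda>c f z. c * f z"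
  by (auto simp: ae_eq_def square_integrable_scale)

text \<open>The real inner product space structure underlying the complex one; its norm is the $L^2$ norm.\<close>

instantiation circle_L2 :: real_inner
begin

lift_definition zero_circle_L2 :: circle_L2 is "\<lambda>z. 0"
  by (simp add: ae_eq_def square_integrable_zero)

lift_definition plus_circle_L2 :: "circle_L2 \<Rightarrow> circle_L2 \<Rightarrow> circle_L2" is "\<lambda>f g z. f z + g z"
  by (auto simp: ae_eq_def square_integrable_add)

definition scaleR_circle_L2 :: "real \<Rightarrow> circle_L2 \<Rightarrow> circle_L2" where
  "scaleR_circle_L2 r = scaleC (complex_of_real r)"

definition uminus_circle_L2 :: "circle_L2 \<Rightarrow> circle_L2" where
  "uminus_circle_L2 = scaleC (- 1)"

definition minus_circle_L2 :: "circle_L2 \<Rightarrow> circle_L2 \<Rightarrow> circle_L2" where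
  "minus_circle_L2 f g = f + - g"

definition inner_circle_L2 :: "circle_L2 \<Rightarrow> circle_L2 \<Rightarrow> real" where
  "inner_circle_L2 f g = Re (cinner f g)"

definition norm_circle_L2 :: "circle_L2 \<Rightarrow> real" where
  "norm_circle_L2 f = sqrt (f \<bullet> f)"

definition sgn_circle_L2 :: "circle_L2 \<Rightarrow> circle_L2" where
  "sgn_circle_L2 f = inverse (norm f) *\<^sub>R f"

definition dist_circle_L2 :: "circle_L2 \<Rightarrow> circle_L2 \<Rightarrow> real" where
  "dist_circle_L2 f g = norm (f - g)"

definition uniformity_circle_L2 :: "(circle_L2 \<times> circle_L2) filter" where
  "uniformity_circle_L2 = (INF e\<in>{0<..}. principal {(x, y). dist x y < e})"

definition open_circle_L2 :: "circle_L2 set \<Rightarrow> bool" where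
  "open_circle_L2 U \<longleftrightarrow> (\<forall>x\<in>U. eventually (\<lambda>(x', y). x' = x \<longrightarrow> y \<in> U) uniformity)"

instance
proof
  fix f g h :: circle_L2 and a b :: real
  show "f + g + h = f + (g + h)"
    by transfer (auto simp: ae_eq_def add.assoc intro!: square_integrable_add)
  show "f + g = g + f"
    by transfer (auto simp: ae_eq_def add.commute intro!: square_integrable_add)
  show "0 + f = f"
    by transfer (auto simp: ae_eq_def)
  show "- f + f = 0"
    unfolding uminus_circle_L2_def
    by transfer (auto simp: ae_eq_def square_integrable_zero)
  show "f - g = f + - g"
    by (rule minus_circle_L2_def)
  show "a *\<^sub>R (f + g) = a *\<^sub>R f + a *\<^sub>R g"
    unfolding scaleR_circle_L2_def
    by transfer (auto simp: ae_eq_def distrib_left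
        intro!: square_integrable_add square_integrable_scale)
  show "(a + b) *\<^sub>R f = a *\<^sub>R f + b *\<^sub>R f"
    unfolding scaleR_circle_L2_def
    by transfer (auto simp: ae_eq_def distrib_right
        intro!: square_integrable_add square_integrable_scale)
  show "a *\<^sub>R b *\<^sub>R f = (a * b) *\<^sub>R f"
    unfolding scaleR_circle_L2_def
    by transfer (auto simp: ae_eq_def mult.assoc intro!: square_integrable_scale)
  show "1 *\<^sub>R f = f"
    unfolding scaleR_circle_L2_def by transfer (auto simp: ae_eq_def)
  show "f \<bullet> g = g \<bullet> f"
    unfolding inner_circle_L2_def
  proof transfer
    fix f g assume "ae_eq f f" "ae_eq g g"
    have "(LINT z|circle_measure. g z * cnj (f z)) = (LINT z|circle_measure. cnj (f z * cnj (g z)))"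
      by (simp add: mult.commute)
    also have "\<dots> = cnj (LINT z|circle_measure. f z * cnj (g z))"
      by (rule Bochner_Integration.integral_cnj)
    finally show "Re (LINT z|circle_measure. f z * cnj (g z))
        = Re (LINT z|circle_measure. g z * cnj (f z))" by simp
  qed
  show "(f + g) \<bullet> h = f \<bullet> h + g \<bullet> h"
    unfolding inner_circle_L2_def
    by transfer (simp add: ae_eq_def distrib_right square_integrable_inner)
  show "(a *\<^sub>R f) \<bullet> g = a * (f \<bullet> g)"
    unfolding inner_circle_L2_def scaleR_circle_L2_def
    by transfer (simp add: ae_eq_def mult.assoc)
  have sq: "Re (LINT z|circle_measure. f z * cnj (f z)) = (LINT z|circle_measure. (norm (f z))\<^sup>2)"
    for f by (simp add: complex_norm_square[symmetric] del: of_real_power)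
  show "0 \<le> f \<bullet> f"
    unfolding inner_circle_L2_def by transfer (simp add: sq)
  show "f \<bullet> f = 0 \<longleftrightarrow> f = 0"
    unfolding inner_circle_L2_def
  proof transfer
    fix f assume "ae_eq f f"
    then show "Re (LINT z|circle_measure. f z * cnj (f z)) = 0 \<longleftrightarrow> ae_eq f (\<lambda>z. 0)"
      unfolding sq by (subst integral_nonneg_eq_0_iff_AE)
        (auto simp: ae_eq_def square_integrable_def)
  qed
qed (simp_all add: norm_circle_L2_def sgn_circle_L2_def dist_circle_L2_def
       uniformity_circle_L2_def open_circle_L2_def)

end

lift_definition monomial :: "int \<Rightarrow> circle_L2" is "\<lambda>n z. z powi n"
proof -
  fix n :: int
  have [measurable]: "(\<lambda>z. z powi n) \<in> borel_measurable circle_measure"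
    unfolding measurable_cong_sets[OF sets_circle_measure refl]
    by (intro borel_measurable_continuous_on_restrict continuous_intros) auto
  interpret prob_space circle_measure by (rule prob_space_circle_measure)
  have "integrable circle_measure (\<lambda>z. (norm (z powi n))\<^sup>2)"
  proof (rule integrable_const_bound[of _ 1])
    show "AE z in circle_measure. norm ((norm (z powi n))\<^sup>2) \<le> 1"
      by (rule AE_I2) (simp add: norm_power_int)
  qed measurable
  then show "ae_eq (\<lambda>z. z powi n) (\<lambda>z. z powi n)"
    by (simp add: ae_eq_def square_integrable_def)
qed

text \<open>Multiplication by \<open>g\<close>, with the dummy value 0 unless \<open>g\<close> is bounded and measurable.\<close>

lift_definition mult_operator :: "(complex \<Rightarrow> complex) \<Rightarrow> circle_L2 \<Rightarrow> circle_L2"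
  is "\<lambda>g f z. if g \<in> borel_measurable circle_measure \<and> bounded (g ` sphere 0 1)
              then g z * f z else 0"
proof -
  fix g f f' assume "ae_eq f f'"
  then show "ae_eq
      (\<lambda>z. if g \<in> borel_measurable circle_measure \<and> bounded (g ` sphere 0 1)
           then g z * f z else 0)
      (\<lambda>z. if g \<in> borel_measurable circle_measure \<and> bounded (g ` sphere 0 1)
           then g z * f' z else 0)"
    by (cases "g \<in> borel_measurable circle_measure \<and> bounded (g ` sphere 0 1)")
      (auto simp: ae_eq_def square_integrable_zero square_integrable_bounded_mult)
qed


section \<open>Random operators on $L^2(S^1)$\<close>

definition bounded_clinear :: "(circle_L2 \<Rightarrow> circle_L2) \<Rightarrow> bool" where
  "bounded_clinear T \<longleftrightarrow> bounded_linear T \<and> (\<forall>c f. T (scaleC c f) = scaleC c (T f))"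

definition random_operator :: "'a measure \<Rightarrow> ('a \<Rightarrow> circle_L2 \<Rightarrow> circle_L2) \<Rightarrow> bool" where
  "random_operator M A \<longleftrightarrow>
     (\<forall>\<omega>\<in>space M. bounded_clinear (A \<omega>)) \<and>
     (\<forall>x y. (\<lambda>\<omega>. cinner (A \<omega> x) y) \<in> borel_measurable M)"

definition matrix_coeff :: "('a \<Rightarrow> circle_L2 \<Rightarrow> circle_L2) \<Rightarrow> int \<Rightarrow> int \<Rightarrow> 'a \<Rightarrow> complex" where
  "matrix_coeff A i j \<omega> = cinner (A \<omega> (monomial j)) (monomial i)"

definition laurent_random_operator :: "'a measure \<Rightarrow> ('a \<Rightarrow> circle_L2 \<Rightarrow> circle_L2) \<Rightarrow> bool" where
  "laurent_random_operator M A \<longleftrightarrow>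
     (\<exists>\<phi>\<in>borel_measurable (M \<Otimes>\<^sub>M circle_measure).
        \<forall>\<omega>\<in>space M. bounded ((\<lambda>z. \<phi> (\<omega>, z)) ` sphere 0 1) \<and>
                    A \<omega> = mult_operator (\<lambda>z. \<phi> (\<omega>, z)))"

end

theory Submission
  imports Defs
begin

text \<open>If the coefficients of $A(\omega)$ depend only on $i - j$, the Fejer means
  $\sigma_n(\omega, z)$ of $A(\omega) e_0$ are jointly measurable, and they equal
  $\frac1n \langle A(\omega) u, u\rangle$ for a vector $u$ with $\|u\|^2 = n$, so they are bounded by
  $\|A(\omega)\|$. They converge to $A(\omega) e_0$ in $L^2$, hence almost everywhere along a
  subsequence, which can be selected measurably in $\omega$. The limit $\varphi$ is jointly
  measurable, bounded in $z$, and $L^\varphi_\omega$ has the same coefficients as $A(\omega)$;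
  completeness of the trigonometric system gives $A = L^\varphi$.\<close>

text \<open>Two demands on phi shape the proof: joint measurability, and boundedness at every point
  of the circle for every omega. Elements of \<open>circle_L2\<close> are classes; a representative
  of A(omega) e_0 chosen for each omega separately would guarantee neither. So phi is built from
  explicit trigonometric polynomials whose coefficients are measurable in omega. Averaging matters
  here: even for a bounded function the partial sums of the Fourier series can be unbounded at a
  point, whereas a Fejer mean is controlled at each single z, and a bound that holds pointwise
  survives the limit. The vector u has entries z^(-j) for j < n; sesquilinearity turns the entry (i,
  j) of the matrix into a factor of z^(i-j), which is how a Toeplitz form reproduces the symbol. The
  L^2 limit alone says nothing about single points, and the speed of convergence depends on omega,
  hence the subsequence that varies with omega.\<close>

section \<open>Representatives and the complex inner product\<close>

lemma ae_eq_refl_iff: "ae_eq f f \<longleftrightarrow> square_integrable f"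
  by (simp add: ae_eq_def)

lemma circle_L2_cases:
  obtains f where "square_integrable f" "x = abs_circle_L2 f"
  by (induction x rule: circle_L2.abs_induct) (auto simp: ae_eq_refl_iff)

lemma abs_circle_L2_eq_iff:
  assumes "square_integrable f" "square_integrable g"
  shows "abs_circle_L2 f = abs_circle_L2 g \<longleftrightarrow> (AE z in circle_measure. f z = g z)"
  using assms Quotient_rel[OF Quotient_circle_L2, of f g] by (auto simp: ae_eq_def)

lemma abs_circle_L2_cong:
  assumes "square_integrable f" "square_integrable g" "\<And>z. norm z = 1 \<Longrightarrow> f z = g z"
  shows "abs_circle_L2 f = abs_circle_L2 g"
  using assms by (intro abs_circle_L2_eq_iff[THEN iffD2] AE_I2) auto

lemma abs_circle_L2_add:
  "square_integrable f \<Longrightarrow> square_integrable g \<Longrightarrow>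
    abs_circle_L2 f + abs_circle_L2 g = abs_circle_L2 (\<lambda>z. f z + g z)"
  by (rule plus_circle_L2.abs_eq) (simp_all add: ae_eq_refl_iff)

lemma scaleC_abs_circle_L2:
  "square_integrable f \<Longrightarrow> scaleC c (abs_circle_L2 f) = abs_circle_L2 (\<lambda>z. c * f z)"
  by (rule scaleC.abs_eq) (simp_all add: ae_eq_refl_iff)

lemma square_integrable_diff:
  "square_integrable f \<Longrightarrow> square_integrable g \<Longrightarrow> square_integrable (\<lambda>z. f z - g z)"
  using square_integrable_add[of f "\<lambda>z. (-1) * g z"] square_integrable_scale[of g "-1"] by simp

lemma abs_circle_L2_diff:
  "square_integrable f \<Longrightarrow> square_integrable g \<Longrightarrow>
    abs_circle_L2 f - abs_circle_L2 g = abs_circle_L2 (\<lambda>z. f z - g z)"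
  using square_integrable_scale[of g "-1"]
  by (simp add: minus_circle_L2_def uminus_circle_L2_def scaleC_abs_circle_L2 abs_circle_L2_add)

lemma square_integrable_sum:
  "(\<And>i. i \<in> I \<Longrightarrow> square_integrable (f i)) \<Longrightarrow> square_integrable (\<lambda>z. \<Sum>i\<in>I. f i z)"
  by (induction I rule: infinite_finite_induct)
    (auto intro!: square_integrable_add square_integrable_zero)

lemma abs_circle_L2_sum:
  assumes "\<And>i. i \<in> I \<Longrightarrow> square_integrable (f i)"
  shows "(\<Sum>i\<in>I. abs_circle_L2 (f i)) = abs_circle_L2 (\<lambda>z. \<Sum>i\<in>I. f i z)"
  using assms
  by (induction I rule: infinite_finite_induct)
    (auto simp: abs_circle_L2_add square_integrable_sum zero_circle_L2_def)

lemma cinner_abs_circle_L2: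
  "square_integrable f \<Longrightarrow> square_integrable g \<Longrightarrow>
    cinner (abs_circle_L2 f) (abs_circle_L2 g) = (LINT z|circle_measure. f z * cnj (g z))"
  by (rule cinner.abs_eq) (simp_all add: ae_eq_refl_iff)

lemma norm_abs_circle_L2:
  assumes "square_integrable f"
  shows "(norm (abs_circle_L2 f))\<^sup>2 = (LINT z|circle_measure. (norm (f z))\<^sup>2)"
  unfolding power2_norm_eq_inner[of "abs_circle_L2 f"] inner_circle_L2_def cinner_abs_circle_L2[OF assms assms]
  by (simp add: complex_norm_square[symmetric] del: of_real_power)

lemma cinner_commute: "cinner x y = cnj (cinner y x)"
proof -
  obtain f g where "square_integrable f" "x = abs_circle_L2 f" "square_integrable g" "y = abs_circle_L2 g"
    by (metis circle_L2_cases)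
  then show ?thesis
    by (simp add: cinner_abs_circle_L2 mult.commute flip: Bochner_Integration.integral_cnj)
qed

lemma cinner_add_left: "cinner (x + y) z = cinner x z + cinner y z"
proof -
  obtain f g h where "square_integrable f" "x = abs_circle_L2 f" "square_integrable g" "y = abs_circle_L2 g"
    "square_integrable h" "z = abs_circle_L2 h"
    by (metis circle_L2_cases)
  then show ?thesis
    by (simp add: cinner_abs_circle_L2 abs_circle_L2_add square_integrable_add distrib_right
        square_integrable_inner)
qed

lemma cinner_scaleC_left: "cinner (scaleC c x) y = c * cinner x y"
proof -
  obtain f g where "square_integrable f" "x = abs_circle_L2 f" "square_integrable g" "y = abs_circle_L2 g"
    by (metis circle_L2_cases)
  then show ?thesis
    by (simp add: cinner_abs_circle_L2 scaleC_abs_circle_L2 square_integrable_scale mult.assoc)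
qed

lemma cinner_add_right: "cinner z (x + y) = cinner z x + cinner z y"
  by (metis cinner_add_left cinner_commute complex_cnj_add)

lemma cinner_scaleC_right: "cinner y (scaleC c x) = cnj c * cinner y x"
  by (metis cinner_scaleC_left cinner_commute complex_cnj_mult)

lemma cinner_scaleR_left: "cinner (r *\<^sub>R x) y = of_real r * cinner x y"
  by (simp add: scaleR_circle_L2_def cinner_scaleC_left)

lemma scaleC_add_right: "scaleC c (x + y) = scaleC c x + scaleC c y"
proof -
  obtain f g where "square_integrable f" "x = abs_circle_L2 f" "square_integrable g" "y = abs_circle_L2 g"
    by (metis circle_L2_cases)
  then show ?thesis
    by (simp add: abs_circle_L2_add scaleC_abs_circle_L2 square_integrable_scale
       square_integrable_add distrib_left)
qed

lemma scaleC_add_left: "scaleC (c + d) x = scaleC c x + scaleC d x"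
proof -
  obtain f where "square_integrable f" "x = abs_circle_L2 f"
    by (metis circle_L2_cases)
  then show ?thesis
    by (simp add: abs_circle_L2_add scaleC_abs_circle_L2 square_integrable_scale distrib_right)
qed

lemma scaleC_scaleC: "scaleC c (scaleC d x) = scaleC (c * d) x"
proof -
  obtain f where "square_integrable f" "x = abs_circle_L2 f"
    by (metis circle_L2_cases)
  then show ?thesis
    by (simp add: scaleC_abs_circle_L2 square_integrable_scale mult.assoc)
qed

lemma scaleC_zero_right: "scaleC c 0 = 0"
  by (metis add_cancel_right_right scaleC_add_right)

lemma scaleC_zero_left: "scaleC 0 x = 0"
  by (metis of_real_0 scaleR_circle_L2_def scaleR_zero_left)

lemma cinner_zero_left: "cinner 0 x = 0"
  by (metis add_cancel_right_right cinner_add_left)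

lemma cinner_zero_right: "cinner x 0 = 0"
  by (metis add_cancel_right_right cinner_add_right)

lemma cinner_sum_left: "cinner (\<Sum>i\<in>I. f i) x = (\<Sum>i\<in>I. cinner (f i) x)"
  by (induction I rule: infinite_finite_induct) (simp_all add: cinner_add_left cinner_zero_left)

lemma cinner_sum_right: "cinner x (\<Sum>i\<in>I. f i) = (\<Sum>i\<in>I. cinner x (f i))"
  by (induction I rule: infinite_finite_induct) (simp_all add: cinner_add_right cinner_zero_right)

lemma scaleC_sum: "scaleC c (\<Sum>i\<in>I. f i) = (\<Sum>i\<in>I. scaleC c (f i))"
  by (induction I rule: infinite_finite_induct) (simp_all add: scaleC_add_right scaleC_zero_right)

text \<open>The real part is the squared norm by construction of the real inner product; Hermitian
  symmetry kills the imaginary part.\<close>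

lemma cinner_self: "cinner x x = of_real ((norm x)\<^sup>2)"
proof -
  have "Im (cinner x x) = 0"
    using cinner_commute[of x x] by (metis add_cancel_right_right complex_cnj_cancel_iff cnj.simps(2) equal_neg_zero)
  then show ?thesis
    by (simp add: complex_eq_iff power2_norm_eq_inner inner_circle_L2_def)
qed

lemma norm_scaleC: "norm (scaleC c x) = norm c * norm x"
proof -
  have "complex_of_real ((norm (scaleC c x))\<^sup>2) = (c * cnj c) * of_real ((norm x)\<^sup>2)"
    unfolding cinner_self[symmetric] by (simp add: cinner_scaleC_left cinner_scaleC_right)
  also have "\<dots> = of_real ((norm c * norm x)\<^sup>2)"
    by (simp only: complex_norm_square[symmetric] of_real_mult[symmetric] power_mult_distrib)
  finally show ?thesis
    by (simp only: of_real_eq_iff) simp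
qed

text \<open>The Cauchy-Schwarz inequality of the class \<open>real_inner\<close> controls only the
  real part. Rotating \<open>x\<close> by the unimodular \<open>c\<close> makes the complex product
  real and equal to its modulus.\<close>

lemma cinner_Cauchy_Schwarz: "norm (cinner x y) \<le> norm x * norm y"
proof (cases "cinner x y = 0")
  case False
  define c where "c = cnj (sgn (cinner x y))"
  have c: "norm c = 1" using False by (simp add: c_def norm_sgn)
  have "cinner (scaleC c x) y = norm (cinner x y)"
    using False unfolding cinner_scaleC_left c_def
    by (simp add: sgn_eq complex_norm_square[symmetric] power2_eq_square field_simps)
  then have "norm (cinner x y) = inner (scaleC c x) y"
    by (simp add: inner_circle_L2_def)
  also have "\<dots> \<le> norm (scaleC c x) * norm y"
    by (rule norm_cauchy_schwarz)
  finally show ?thesis by (simp add: norm_scaleC c)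
qed simp

section \<open>Orthonormality of the monomials and convergence of representatives\<close>

lemma square_integrable_powi: "square_integrable (\<lambda>z. z powi n)"
  using monomial.rsp by (simp add: rel_fun_def ae_eq_def eq_onp_def)

lemma monomial_eq: "monomial n = abs_circle_L2 (\<lambda>z. z powi n)"
  by (rule monomial.abs_eq)

lemma cnj_eq_inverse: "norm z = 1 \<Longrightarrow> cnj z = inverse z"
  using complex_norm_square[of z] by (intro inverse_unique[symmetric]) simp

text \<open>Passage to the angle variable. The null point \<open>2 * pi\<close> is added to the
  half-open interval so that the fundamental theorem of calculus on a closed interval
  applies.\<close>

lemma integral_circle_measure:
  fixes f :: "complex \<Rightarrow> complex"
  assumes "f \<in> borel_measurable circle_measure"
  shows "(LINT z|circle_measure. f z) = (LINT t|lborel. indicator {0..2 * pi} t *\<^sub>R (f (cis t) / (2 * pi)))"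
proof -
  have cis [measurable]: "cis \<in> borel \<rightarrow>\<^sub>M restrict_space borel (sphere 0 1)"
    by (intro measurable_restrict_space2 borel_measurable_continuous_onI continuous_intros) auto
  have f [measurable]: "f \<in> borel_measurable (restrict_space borel (sphere 0 1))"
    using assms measurable_cong_sets[OF sets_circle_measure refl] by blast
  have dens: "uniform_measure lborel {0..<2 * pi} =
      density lborel (\<lambda>t. ennreal (indicator {0..<2 * pi} t / (2 * pi)))"
    unfolding uniform_measure_def
    using divide_ennreal[of 1 "2 * pi"] by (intro density_cong) (auto simp: indicator_def)
  have "(LINT z|circle_measure. f z) =
      (LINT t|lborel. (indicator {0..<2 * pi} t / (2 * pi)) *\<^sub>R f (cis t))"
    unfolding circle_measure_def dens
    by (subst integral_distr, simp, simp, subst integral_density) auto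
  also have "\<dots> = (LINT t|lborel. indicator {0..2 * pi} t *\<^sub>R (f (cis t) / (2 * pi)))"
  proof (rule integral_cong_AE)
    show "AE t in lborel. (indicator {0..<2 * pi} t / (2 * pi)) *\<^sub>R f (cis t) =
        indicator {0..2 * pi} t *\<^sub>R (f (cis t) / (2 * pi))"
      using AE_lborel_singleton[of "2 * pi"]
      by eventually_elim (auto simp: indicator_def scaleR_conv_of_real)
  qed auto
  finally show ?thesis .
qed

lemma cinner_monomial: "cinner (monomial m) (monomial n) = (if m = n then 1 else 0)"
proof -
  define k where "k = m - n"
  have meas: "(\<lambda>z. z powi k) \<in> borel_measurable circle_measure"
    using square_integrable_powi by (rule square_integrable_measurable)
  have "cinner (monomial m) (monomial n) = (LINT z|circle_measure. z powi m * cnj (z powi n))"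
    by (simp add: monomial_eq cinner_abs_circle_L2 square_integrable_powi)
  also have "\<dots> = (LINT z|circle_measure. z powi k)"
  proof (intro Bochner_Integration.integral_cong refl)
    fix z assume "z \<in> space circle_measure"
    then have z: "norm z = 1" "z \<noteq> 0" by auto
    then have "cnj z = inverse z"
      by (simp only: cnj_eq_inverse)
    then have "cnj (z powi n) = z powi (- n)"
      by (simp add: power_int_def power_inverse)
    then show "z powi m * cnj (z powi n) = z powi k"
      using z by (simp add: k_def power_int_diff power_int_minus divide_inverse)
  qed
  also have "\<dots> = (LINT t|lborel. indicator {0..2 * pi} t *\<^sub>R (cis t powi k / (2 * pi)))"
    using meas by (rule integral_circle_measure)
  also have "\<dots> = (LINT t|lborel. indicator {0..2 * pi} t *\<^sub>R (cis (of_int k * t) / (2 * pi)))"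
    by (simp add: cis_power_int)
  also have "\<dots> = (if m = n then 1 else 0)"
  proof (cases "k = 0")
    case True
    then show ?thesis by (simp add: k_def scaleR_conv_of_real)
  next
    case False
    \<comment> \<open>A primitive of the integrand, available because \<open>k\<close> is nonzero;
      its period \<open>2 * pi\<close> makes the integral vanish.\<close>
    define F where "F t = cis (of_int k * t) / (2 * pi * \<i> * of_int k)" for t :: real
    have "(LINT t|lborel. indicator {0..2 * pi} t *\<^sub>R (cis (of_int k * t) / (2 * pi))) = F (2 * pi) - F 0"
    proof (rule integral_FTC_Icc)
      fix t
      show "(F has_vector_derivative cis (of_int k * t) / (2 * pi)) (at t within {0..2 * pi})"
      proof -
        have "((\<lambda>w. exp (\<i> * of_int k * w) / (2 * pi * \<i> * of_int k)) has_field_derivative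
            exp (\<i> * of_int k * of_real t) / (2 * pi)) (at (of_real t))"
          using False by (auto intro!: derivative_eq_intros)
        from has_vector_derivative_real_field[OF this] show ?thesis
          by (simp add: F_def[abs_def] cis_conv_exp mult.assoc)
      qed
    qed (auto intro!: continuous_intros)
    also have "F (2 * pi) = F 0"
    proof -
      have "cis (of_int k * (2 * pi)) = 1"
        using cis_multiple_2pi[of "of_int k"] by (simp add: mult.commute)
      then show ?thesis by (simp add: F_def)
    qed
    finally show ?thesis using False by (auto simp: k_def)
  qed
  finally show ?thesis .
qed

lemma square_integrable_bound:
  assumes [measurable]: "f \<in> borel_measurable circle_measure"
    and "square_integrable g" "\<And>z. norm z = 1 \<Longrightarrow> norm (f z) \<le> norm (g z)"
  shows "square_integrable f"
proof -
  have "integrable circle_measure (\<lambda>z. (norm (f z))\<^sup>2)"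
  proof (rule Bochner_Integration.integrable_bound[of _ "\<lambda>z. (norm (g z))\<^sup>2"])
    show "AE z in circle_measure. norm ((norm (f z))\<^sup>2) \<le> norm ((norm (g z))\<^sup>2)"
      using assms(3) by (intro AE_I2) (simp add: power_mono)
  qed (use assms(2) in \<open>simp_all add: square_integrable_def\<close>)
  then show ?thesis by (simp add: square_integrable_def)
qed

text \<open>The squared distance of the classes is the integral of |f n - h|^2, dominated by 4 |g|^2
  because both functions are bounded by |g|. Every limit in the density proof is taken through this
  lemma.\<close>

lemma abs_circle_L2_dominated_convergence:
  assumes [measurable]: "\<And>n. f n \<in> borel_measurable circle_measure"
    and g: "square_integrable g" and bound: "\<And>n z. norm z = 1 \<Longrightarrow> norm (f n z) \<le> norm (g z)"
    and lim: "\<And>z. norm z = 1 \<Longrightarrow> (\<lambda>n. f n z) \<longlonglongrightarrow> h z"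
  shows "square_integrable h" "(\<lambda>n. abs_circle_L2 (f n)) \<longlonglongrightarrow> abs_circle_L2 h"
proof -
  have h [measurable]: "h \<in> borel_measurable circle_measure"
    by (rule borel_measurable_LIMSEQ_metric[of f]) (simp_all add: lim)
  have hb: "norm (h z) \<le> norm (g z)" if "norm z = 1" for z
    using LIMSEQ_le_const2[OF tendsto_norm[OF lim[OF that]]] bound[OF that] by blast
  show sq: "square_integrable h"
    using h g hb by (rule square_integrable_bound)
  have sqf: "square_integrable (f n)" for n
    using assms(1) g bound by (rule square_integrable_bound)
  have "(\<lambda>n. LINT z|circle_measure. (norm (f n z - h z))\<^sup>2) \<longlonglongrightarrow> (LINT z|circle_measure. 0)"
  proof (rule integral_dominated_convergence)
    show "integrable circle_measure (\<lambda>z. 4 * (norm (g z))\<^sup>2)"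
      using g by (simp add: square_integrable_def)
    show "AE z in circle_measure. (\<lambda>n. (norm (f n z - h z))\<^sup>2) \<longlonglongrightarrow> 0"
    proof (rule AE_I2)
      fix z assume "z \<in> space circle_measure"
      then have "(\<lambda>n. f n z - h z) \<longlonglongrightarrow> 0"
        using lim[of z] by (simp add: LIM_zero)
      from tendsto_power[OF tendsto_norm[OF this], of 2]
      show "(\<lambda>n. (norm (f n z - h z))\<^sup>2) \<longlonglongrightarrow> 0" by simp
    qed
    show "AE z in circle_measure. norm ((norm (f n z - h z))\<^sup>2) \<le> 4 * (norm (g z))\<^sup>2" for n
    proof (rule AE_I2)
      fix z assume "z \<in> space circle_measure"
      then have "norm (f n z - h z) \<le> 2 * norm (g z)"
        using bound[of z n] hb[of z] norm_triangle_ineq4[of "f n z" "h z"] by simp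
      then have "(norm (f n z - h z))\<^sup>2 \<le> (2 * norm (g z))\<^sup>2"
        by (rule power_mono) simp
      then show "norm ((norm (f n z - h z))\<^sup>2) \<le> 4 * (norm (g z))\<^sup>2"
        by (simp add: power_mult_distrib)
    qed
  qed auto
  then have "(\<lambda>n. (norm (abs_circle_L2 (f n) - abs_circle_L2 h))\<^sup>2) \<longlonglongrightarrow> 0"
    by (simp add: abs_circle_L2_diff norm_abs_circle_L2 square_integrable_diff sqf sq)
  from tendsto_real_sqrt[OF this] have "(\<lambda>n. norm (abs_circle_L2 (f n) - abs_circle_L2 h)) \<longlonglongrightarrow> 0"
    by simp
  then show "(\<lambda>n. abs_circle_L2 (f n)) \<longlonglongrightarrow> abs_circle_L2 h"
    by (simp add: tendsto_norm_zero_iff LIM_zero_cancel)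
qed

section \<open>Density of trigonometric polynomials\<close>

text \<open>The functions live on the whole plane, but identities such as
  \<open>cnj z = inverse z\<close> hold only on the circle; the clause \<open>cong\<close> makes the
  class insensitive to values elsewhere.\<close>

inductive trig_poly :: "(complex \<Rightarrow> complex) \<Rightarrow> bool" where
  monom: "trig_poly (\<lambda>z. c * z powi n)"
| add: "trig_poly f \<Longrightarrow> trig_poly g \<Longrightarrow> trig_poly (\<lambda>z. f z + g z)"
| cong: "trig_poly f \<Longrightarrow> (\<And>z. norm z = 1 \<Longrightarrow> f z = g z) \<Longrightarrow> trig_poly g"

lemma trig_poly_const: "trig_poly (\<lambda>z. c)"
  using trig_poly.monom[of c 0] by simp

lemma trig_poly_monom_mult: "trig_poly g \<Longrightarrow> trig_poly (\<lambda>z. c * z powi n * g z)"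
proof (induction rule: trig_poly.induct)
  case (monom d m)
  show ?case
  proof (rule trig_poly.cong[OF trig_poly.monom[of "c * d" "n + m"]])
    fix z :: complex
    assume "norm z = 1"
    then have "z \<noteq> 0" by auto
    then show "c * d * z powi (n + m) = c * z powi n * (d * z powi m)"
      by (simp add: power_int_add)
  qed
next
  case (add f g)
  then show ?case
    by (simp add: distrib_left trig_poly.add)
next
  case (cong f g)
  then show ?case
    by (elim trig_poly.cong) auto
qed

lemma trig_poly_mult: "trig_poly f \<Longrightarrow> trig_poly g \<Longrightarrow> trig_poly (\<lambda>z. f z * g z)"
proof (induction rule: trig_poly.induct)
  case (monom d m)
  then show ?case by (rule trig_poly_monom_mult)
next
  case (add f g)
  then show ?case
    by (simp add: distrib_right trig_poly.add)
next
  case (cong f h)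
  have "trig_poly (\<lambda>z. f z * g z)" using cong by blast
  then show ?case
    by (rule trig_poly.cong) (simp add: cong.hyps)
qed

text \<open>Links the Stone-Weierstrass theorem, which speaks of polynomials in the real
  coordinates, to powers of \<open>z\<close>.\<close>

lemma trig_poly_real_polynomial_function:
  "real_polynomial_function p \<Longrightarrow> trig_poly (\<lambda>z. of_real (p z))"
proof (induction rule: real_polynomial_function.induct)
  case (linear f)
  then interpret bounded_linear f .
  \<comment> \<open>The coefficients come from inserting Re z = (z + 1/z) / 2 and Im z = (z - 1/z) /
    (2 i), valid on the circle, into f(z) = Re z f(1) + Im z f(i).\<close>
  have "trig_poly (\<lambda>z. (f 1 - \<i> * f \<i>) / 2 * z powi 1 + (f 1 + \<i> * f \<i>) / 2 * z powi (-1))"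
    by (intro trig_poly.add trig_poly.monom)
  then show ?case
  proof (rule trig_poly.cong)
    fix z :: complex
    assume z: "norm z = 1"
    have inv: "z powi (- 1) = cnj z"
      using z by (simp add: power_int_minus cnj_eq_inverse)
    have "f z = f (Re z *\<^sub>R 1 + Im z *\<^sub>R \<i>)"
      by (rule arg_cong[of _ _ f]) (simp add: complex_eq_iff)
    also have "\<dots> = Re z * f 1 + Im z * f \<i>"
      by (simp only: add scaleR) simp
    finally show "(f 1 - \<i> * f \<i>) / 2 * z powi 1 + (f 1 + \<i> * f \<i>) / 2 * z powi (-1) = of_real (f z)"
      unfolding inv by (simp add: complex_eq_iff field_simps)
  qed
next
  case (const c)
  then show ?case by (rule trig_poly_const)
next
  case (add f g)
  then show ?case by (simp add: trig_poly.add)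
next
  case (mult f g)
  then show ?case by (simp add: trig_poly_mult)
qed

text \<open>\<open>span\<close> is the real span; with all complex multiples of the monomials as
  generators it becomes the complex span of the monomials.\<close>

definition trig_span :: "circle_L2 set" where
  "trig_span = span {scaleC c (monomial n) |c n. True}"

lemma trig_poly_square_integrable: "trig_poly f \<Longrightarrow> square_integrable f"
proof (induction rule: trig_poly.induct)
  case (monom c n)
  then show ?case by (intro square_integrable_scale square_integrable_powi)
next
  case (add f g)
  then show ?case by (simp add: square_integrable_add)
next
  case (cong f g)
  have "g \<in> borel_measurable circle_measure"
    using cong by (subst measurable_cong[of _ _ f]) (auto dest: square_integrable_measurable)
  then show ?case
    by (rule square_integrable_bound[OF _ cong.IH]) (simp add: cong.hyps)
qed

lemma trig_poly_in_trig_span: "trig_poly f \<Longrightarrow> abs_circle_L2 f \<in> trig_span"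
proof (induction rule: trig_poly.induct)
  case (monom c n)
  have "abs_circle_L2 (\<lambda>z. c * z powi n) = scaleC c (monomial n)"
    by (simp add: monomial_eq scaleC_abs_circle_L2 square_integrable_powi)
  then show ?case by (auto simp: trig_span_def intro: span_base)
next
  case (add f g)
  then show ?case
    by (simp add: trig_poly_square_integrable trig_span_def span_add flip: abs_circle_L2_add)
next
  case (cong f g)
  then have "abs_circle_L2 f = abs_circle_L2 g"
    by (intro abs_circle_L2_cong) (auto intro: trig_poly_square_integrable trig_poly.cong)
  then show ?case using cong by simp
qed

lemma square_integrable_const: "square_integrable (\<lambda>z. c)"
  by (intro trig_poly_square_integrable trig_poly_const)

lemma circle_borel_measurableI:
  "f \<in> borel_measurable borel \<Longrightarrow> f \<in> borel_measurable circle_measure"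
  unfolding measurable_cong_sets[OF sets_circle_measure refl] by (rule measurable_restrict_space1)

lemma square_integrable_indicator:
  assumes "A \<in> sets borel"
  shows "square_integrable (\<lambda>z. c * indicator A z)"
proof (rule square_integrable_bound[where g = "\<lambda>z. c"])
  show "(\<lambda>z. c * indicator A z) \<in> borel_measurable circle_measure"
    using assms by (intro circle_borel_measurableI borel_measurable_times borel_measurable_indicator) auto
qed (auto simp: square_integrable_const indicator_def)

lemma closure_subspace_add:
  fixes S :: "'b::real_normed_vector set"
  assumes "subspace S" "x \<in> closure S" "y \<in> closure S"
  shows "x + y \<in> closure S"
proof -
  obtain f g where "\<And>n. f n \<in> S" "f \<longlonglongrightarrow> x" "\<And>n. g n \<in> S" "g \<longlonglongrightarrow> y"
    using assms(2,3) by (auto simp: closure_sequential)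
  then show ?thesis
    unfolding closure_sequential using assms(1)
    by (intro exI[of _ "\<lambda>n. f n + g n"]) (auto intro: tendsto_add subspace_add)
qed

lemma closure_trig_span_sum:
  "(\<And>i. i \<in> I \<Longrightarrow> f i \<in> closure trig_span) \<Longrightarrow> (\<Sum>i\<in>I. f i) \<in> closure trig_span"
proof (induction I rule: infinite_finite_induct)
  case (insert i I)
  then show ?case by (simp add: closure_subspace_add trig_span_def)
qed (auto intro!: closure_subset[THEN subsetD] simp: trig_span_def span_zero)

lemma tendsto_in_closure:
  fixes f :: "nat \<Rightarrow> 'b::real_normed_vector"
  shows "f \<longlonglongrightarrow> x \<Longrightarrow> (\<And>n. f n \<in> closure S) \<Longrightarrow> x \<in> closure S"
  using closed_sequentially[OF closed_closure] by blast

text \<open>Uniform approximation by Stone-Weierstrass, with majorant |c| (B + 1) where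
  \<open>B\<close> bounds |h| on the circle. The complex factor \<open>c\<close> is carried from
  here up to Borel indicators because the closure is handled as a real subspace, while simple
  functions require complex multiples.\<close>

lemma continuous_in_closure_trig_span:
  fixes h :: "complex \<Rightarrow> real"
  assumes h: "continuous_on UNIV h"
  shows "abs_circle_L2 (\<lambda>z. c * of_real (h z)) \<in> closure trig_span"
proof -
  have "\<exists>p. real_polynomial_function p \<and> (\<forall>z\<in>sphere 0 1. \<bar>h z - p z\<bar> < 1 / Suc n)" for n
  proof -
    obtain p where "real_polynomial_function p" "\<And>z. z \<in> sphere 0 1 \<Longrightarrow> \<bar>h z - p z\<bar> < 1 / Suc n"
      using Stone_Weierstrass_real_polynomial_function[OF compact_sphere continuous_on_subset[OF h subset_UNIV],
          of "1 / Suc n" 0 1] by (metis of_nat_0_less_iff zero_less_Suc zero_less_divide_1_iff)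
    then show ?thesis by blast
  qed
  then obtain p where "\<forall>n. real_polynomial_function (p n) \<and> (\<forall>z\<in>sphere 0 1. \<bar>h z - p n z\<bar> < 1 / Suc n)"
    by metis
  then have p: "real_polynomial_function (p n)"
    and close: "norm z = 1 \<Longrightarrow> \<bar>h z - p n z\<bar> < 1 / Suc n" for n z
    by auto
  have "bounded (h ` sphere 0 1)"
    by (intro compact_imp_bounded compact_continuous_image continuous_on_subset[OF h]) auto
  then obtain B where "\<forall>x\<in>h ` sphere 0 1. norm x \<le> B"
    unfolding bounded_iff by blast
  then have B: "\<bar>h z\<bar> \<le> B" if "norm z = 1" for z
    using that by simp
  have tp: "trig_poly (\<lambda>z. c * of_real (p n z))" for n
    by (intro trig_poly_mult trig_poly_const trig_poly_real_polynomial_function p)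
  show ?thesis
  proof (rule tendsto_in_closure[OF abs_circle_L2_dominated_convergence(2)[where g = "\<lambda>z. c * of_real (B + 1)"]])
    show "(\<lambda>z. c * of_real (p n z)) \<in> borel_measurable circle_measure" for n
      using tp by (intro square_integrable_measurable trig_poly_square_integrable)
    show "square_integrable (\<lambda>z. c * of_real (B + 1))"
      by (rule square_integrable_const)
    show "abs_circle_L2 (\<lambda>z. c * of_real (p n z)) \<in> closure trig_span" for n
      using trig_poly_in_trig_span[OF tp] closure_subset by blast
    fix z :: complex assume z: "norm z = 1"
    show "norm (c * of_real (p n z)) \<le> norm (c * of_real (B + 1))" for n
    proof -
      have "\<bar>p n z\<bar> \<le> \<bar>h z\<bar> + \<bar>h z - p n z\<bar>" by linarith
      also have "\<dots> \<le> B + 1 / Suc n" using B[OF z] close[OF z, of n] by linarith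
      also have "\<dots> \<le> B + 1" by simp
      also have "\<dots> \<le> \<bar>B + 1\<bar>" by simp
      finally show ?thesis by (simp add: norm_mult mult_left_mono del: of_real_add)
    qed
    have "(\<lambda>n. p n z) \<longlonglongrightarrow> h z"
    proof (rule LIMSEQ_norm_0[THEN LIM_zero_cancel])
      show "norm (p n z - h z) < 1 / real (Suc n)" for n
        using close[OF z, of n] by (simp add: abs_minus_commute)
    qed
    then show "(\<lambda>n. c * of_real (p n z)) \<longlonglongrightarrow> c * of_real (h z)"
      by (intro tendsto_intros)
  qed
qed

lemma closed_indicator_in_closure_trig_span:
  assumes "closed C"
  shows "abs_circle_L2 (\<lambda>z. c * indicator C z) \<in> closure trig_span"
\<comment> \<open>By convention \<open>infdist z {} = 0\<close>, so for the empty set the bump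
  functions below would be constantly 1 instead of tending to 0.\<close>
proof (cases "C = {}")
  case True
  then show ?thesis
    using trig_poly_in_trig_span[OF trig_poly_const[of 0]] closure_subset by auto
next
  case False
  \<comment> \<open>Continuous bumps equal to 1 on \<open>C\<close> and to 0 at distance at least
    1/n from it; as \<open>C\<close> is closed, they converge pointwise to its indicator.\<close>
  define h where "h n z = max 0 (1 - real n * infdist z C)" for n and z :: complex
  have cont: "continuous_on UNIV (h n)" for n
    unfolding h_def by (intro continuous_intros)
  show ?thesis
  proof (rule tendsto_in_closure[OF abs_circle_L2_dominated_convergence(2)[where g = "\<lambda>z. c"]])
    show "(\<lambda>z. c * of_real (h n z)) \<in> borel_measurable circle_measure" for n
      by (intro circle_borel_measurableI borel_measurable_continuous_onI continuous_intros cont)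
    show "square_integrable (\<lambda>z. c)"
      by (rule square_integrable_const)
    show "abs_circle_L2 (\<lambda>z. c * of_real (h n z)) \<in> closure trig_span" for n
      using cont by (rule continuous_in_closure_trig_span)
    fix z :: complex
    have "0 \<le> h n z \<and> h n z \<le> 1" for n
      by (simp add: h_def infdist_nonneg)
    then show "norm (c * of_real (h n z)) \<le> norm c" for n
      by (simp add: norm_mult mult_left_le)
    show "(\<lambda>n. c * of_real (h n z)) \<longlonglongrightarrow> c * indicator C z"
    proof (cases "z \<in> C")
      case True
      then show ?thesis by (simp add: h_def)
    next
      case z: False
      then have d: "infdist z C > 0"
        using assms False by (simp add: infdist_pos_not_in_closed)
      obtain N where N: "1 < real N * infdist z C"
        using reals_Archimedean3[OF d] by blast
      have "\<forall>\<^sub>F n in sequentially. h n z = 0"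
        using eventually_ge_at_top[of N]
      proof eventually_elim
        case (elim n)
        then have "real N * infdist z C \<le> real n * infdist z C"
          using d by (intro mult_right_mono) auto
        then show ?case using N by (simp add: h_def)
      qed
      then have "\<forall>\<^sub>F n in sequentially. c * of_real (h n z) = c * indicator C z"
        by eventually_elim (use z in simp)
      then show ?thesis by (rule tendsto_eventually)
    qed
  qed
qed

text \<open>Dynkin's pi-lambda argument: the closed sets are stable under intersection and generate
  the Borel sets, and the property passes to complements and to countable disjoint unions.\<close>

lemma borel_indicator_in_closure_trig_span:
  assumes "A \<in> sets borel"
  shows "abs_circle_L2 (\<lambda>z. c * indicator A z) \<in> closure trig_span"
proof -
  have A: "A \<in> sigma_sets UNIV (Collect closed)"
    using assms by (simp add: borel_eq_closed)
  have borel: "B \<in> sets borel" if "B \<in> sigma_sets UNIV (Collect closed)" for B :: "complex set"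
    using that by (simp add: borel_eq_closed)
  note sq = square_integrable_indicator
  have "Int_stable (Collect closed :: complex set set)"
    by (auto simp: Int_stable_def)
  moreover have "Collect closed \<subseteq> Pow (UNIV :: complex set)"
    by simp
  ultimately show ?thesis
    using A
  proof (induction arbitrary: c rule: sigma_sets_induct_disjoint)
    case (basic C)
    then show ?case by (simp add: closed_indicator_in_closure_trig_span)
  next
    case empty
    show ?case using closed_indicator_in_closure_trig_span[of "{}"] by simp
  next
    case (compl B)
    have "abs_circle_L2 (\<lambda>z. c * indicator UNIV z) + abs_circle_L2 (\<lambda>z. - c * indicator B z) \<in> closure trig_span"
      by (rule closure_subspace_add[OF _ closed_indicator_in_closure_trig_span[OF closed_UNIV] compl(2)])
        (simp add: trig_span_def)
    also have "abs_circle_L2 (\<lambda>z. c * indicator UNIV z) + abs_circle_L2 (\<lambda>z. - c * indicator B z) =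
      abs_circle_L2 (\<lambda>z. c * indicator UNIV z + - c * indicator B z)"
      using borel[OF compl(1)] by (intro abs_circle_L2_add sq) auto
    also have "(\<lambda>z. c * indicator UNIV z + - c * indicator B z) = (\<lambda>z. c * indicator (UNIV - B) z)"
      by (auto simp: indicator_def)
    finally show ?case .
  next
    case (union B)
    have B: "B i \<in> sets borel" for i using union(2) borel by blast
    show ?case
    proof (rule tendsto_in_closure[OF abs_circle_L2_dominated_convergence(2)[where g = "\<lambda>z. c"]])
      show "(\<lambda>z. \<Sum>i<n. c * indicator (B i) z) \<in> borel_measurable circle_measure" for n
        by (intro square_integrable_measurable square_integrable_sum sq B)
      show "square_integrable (\<lambda>z. c)"
        by (rule square_integrable_const)
      show "abs_circle_L2 (\<lambda>z. \<Sum>i<n. c * indicator (B i) z) \<in> closure trig_span" for n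
        using union(3) by (subst abs_circle_L2_sum[symmetric]) (auto intro: sq B closure_trig_span_sum)
      fix z :: complex
      \<comment> \<open>Disjointness turns the partial sum into a single indicator, which yields
        both the constant majorant and the pointwise limit.\<close>
      have eq: "(\<Sum>i<n. c * indicator (B i) z) = c * indicator (\<Union>i<n. B i) z" for n
        using disjoint_family_on_mono[OF _ union(1), of "{..<n}"]
        by (simp add: indicator_UN_disjoint flip: sum_distrib_left)
      show "norm (\<Sum>i<n. c * indicator (B i) z) \<le> norm c" for n
        unfolding eq by (simp add: indicator_def)
      show "(\<lambda>n. \<Sum>i<n. c * indicator (B i) z) \<longlonglongrightarrow> c * indicator (\<Union>i. B i) z"
        unfolding eq by (intro tendsto_intros LIMSEQ_indicator_UN)
    qed
  qed
qed

theorem trig_span_dense: "closure trig_span = UNIV"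
proof -
  have "x \<in> closure trig_span" for x
  proof -
    obtain f where f: "square_integrable f" "x = abs_circle_L2 f"
      by (rule circle_L2_cases)
    obtain s where s: "\<And>i. simple_function circle_measure (s i)"
      "\<And>z. z \<in> space circle_measure \<Longrightarrow> (\<lambda>i. s i z) \<longlonglongrightarrow> f z"
      "\<And>i z. z \<in> space circle_measure \<Longrightarrow> dist (s i z) 0 \<le> 2 * dist (f z) 0"
      using borel_measurable_implies_sequence_metric[OF square_integrable_measurable[OF f(1)], of 0] by blast
    show ?thesis
      unfolding f(2)
    proof (rule tendsto_in_closure[OF abs_circle_L2_dominated_convergence(2)[where g = "\<lambda>z. 2 * f z"]])
      show "s i \<in> borel_measurable circle_measure" for i
        using s(1) by (rule borel_measurable_simple_function)
      show "square_integrable (\<lambda>z. 2 * f z)"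
        using f(1) by (rule square_integrable_scale)
      show "norm (s i z) \<le> norm (2 * f z)" "(\<lambda>n. s n z) \<longlonglongrightarrow> f z" if "norm z = 1" for i z
        using s(2,3)[of z] that by (auto simp: norm_mult)
      show "abs_circle_L2 (s i) \<in> closure trig_span" for i
      proof -
        let ?A = "\<lambda>y. s i -` {y} \<inter> sphere 0 1"
        have fin: "finite (s i ` sphere 0 1)"
          using s(1)[of i] by (simp add: simple_function_def)
        \<comment> \<open>Measurable subsets of the circle are traces of Borel sets, and the circle
          is itself Borel in the plane, so level sets are Borel in the plane.\<close>
        have A: "?A y \<in> sets borel" for y
        proof -
          have "?A y \<in> sets circle_measure"
            using simple_functionD(2)[OF s(1), of i "{y}"] by simp
          then show ?thesis
            by (auto simp: sets_circle_measure sets_restrict_space)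
        qed
        note sq = square_integrable_indicator[OF A]
        have val: "(\<Sum>y\<in>s i ` sphere 0 1. y * indicator (?A y) z) = s i z" if "norm z = 1" for z
          using that fin by (subst sum.remove[of _ "s i z"]) (auto intro!: sum.neutral simp: indicator_def)
        have "square_integrable (s i)"
          using borel_measurable_simple_function[OF s(1)] square_integrable_scale[OF f(1), of 2]
          by (rule square_integrable_bound) (use s(3)[of _ i] in \<open>simp add: norm_mult\<close>)
        then have "abs_circle_L2 (s i) = (\<Sum>y\<in>s i ` sphere 0 1. abs_circle_L2 (\<lambda>z. y * indicator (?A y) z))"
          unfolding abs_circle_L2_sum[OF sq]
          by (intro abs_circle_L2_cong square_integrable_sum sq) (simp_all add: val)
        then show ?thesis
          by (simp add: closure_trig_span_sum borel_indicator_in_closure_trig_span A)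
      qed
    qed
  qed
  then show ?thesis by blast
qed

section \<open>Fejer means\<close>

definition trig_proj :: "int set \<Rightarrow> circle_L2 \<Rightarrow> circle_L2" where
  "trig_proj K x = (\<Sum>k\<in>K. scaleC (cinner x (monomial k)) (monomial k))"

text \<open>For finite \<open>K\<close>, the vectors x and Px have the same coefficients on
  \<open>K\<close>, so <Px, Px> = <x, Px>, and Cauchy-Schwarz applies. For infinite \<open>K\<close>
  the sum is 0 by convention.\<close>

lemma norm_trig_proj_le: "norm (trig_proj K x) \<le> norm x"
proof (cases "finite K")
  case True
  have coeff: "cinner (trig_proj K x) (monomial k) = cinner x (monomial k)" if "k \<in> K" for k
    using that True unfolding trig_proj_def
    by (simp add: cinner_sum_left cinner_scaleC_left cinner_monomial if_distrib cong: if_cong)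
  have expand: "cinner y (trig_proj K x) =
      (\<Sum>k\<in>K. cnj (cinner x (monomial k)) * cinner y (monomial k))" for y
    by (simp add: trig_proj_def cinner_sum_right cinner_scaleC_right)
  have "cinner (trig_proj K x) (trig_proj K x) = cinner x (trig_proj K x)"
    unfolding expand by (simp add: coeff)
  then have "(norm (trig_proj K x))\<^sup>2 = inner x (trig_proj K x)"
    by (simp add: power2_norm_eq_inner inner_circle_L2_def)
  also have "\<dots> \<le> norm x * norm (trig_proj K x)"
    by (rule norm_cauchy_schwarz)
  finally show ?thesis
    by (cases "trig_proj K x = 0") (simp_all add: power2_eq_square)
qed (simp add: trig_proj_def)

lemma bounded_linear_trig_proj: "bounded_linear (trig_proj K)"
  by (rule bounded_linear_intro[where K=1])
    (simp_all add: norm_trig_proj_le, simp_all add: trig_proj_def cinner_add_left scaleC_add_left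
      sum.distrib cinner_scaleR_left scaleR_circle_L2_def scaleC_scaleC cinner_scaleC_left scaleC_sum)

lemma trig_proj_monomial:
  "finite K \<Longrightarrow> trig_proj K (scaleC c (monomial k)) = (if k \<in> K then scaleC c (monomial k) else 0)"
  by (simp add: trig_proj_def cinner_scaleC_left cinner_monomial if_distrib if_distribR scaleC_zero_left
      cong: if_cong)

text \<open>The average of the projections onto the windows $(i - n, i]$, $0 \le i < n$, is the
  $n$-th Fejer mean.\<close>

definition fejer :: "nat \<Rightarrow> circle_L2 \<Rightarrow> circle_L2" where
  "fejer n x = (1 / n) *\<^sub>R (\<Sum>i<n. trig_proj {int i - int n<..int i} x)"

lemma bounded_linear_fejer: "bounded_linear (fejer n)"
  unfolding fejer_def
  by (intro bounded_linear_compose[OF bounded_linear_scaleR_right] bounded_linear_sum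
      bounded_linear_trig_proj)

lemma norm_fejer_le: "norm (fejer n x) \<le> norm x"
proof (cases "n = 0")
  case False
  have "norm (\<Sum>i<n. trig_proj {int i - int n<..int i} x) \<le> (\<Sum>i<n. norm x)"
    by (intro sum_norm_le norm_trig_proj_le)
  then show ?thesis
    using False by (simp add: fejer_def divide_simps mult.commute)
qed (simp add: fejer_def)

text \<open>The window of \<open>i\<close> contains \<open>k\<close> iff k <= i < n + k, so e_k is
  multiplied by a weight between 1 - |k|/n and 1.\<close>

lemma fejer_monomial_tendsto: "(\<lambda>n. fejer n (scaleC c (monomial k))) \<longlonglongrightarrow> scaleC c (monomial k)"
proof -
  let ?x = "scaleC c (monomial k)"
  define good where "good n = {i. i < n \<and> k \<in> {int i - int n<..int i}}" for n
  have fej: "fejer n ?x = (card (good n) / n) *\<^sub>R ?x" for n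
  proof -
    have "(\<Sum>i<n. trig_proj {int i - int n<..int i} ?x) = (\<Sum>i\<in>good n. ?x)"
      by (intro sum.mono_neutral_cong_right) (auto simp: good_def trig_proj_monomial)
    then show ?thesis by (simp add: fejer_def sum_constant_scaleR)
  qed
  have card_le: "card (good n) \<le> n" for n
    using card_mono[of "{..<n}" "good n"] by (auto simp: good_def)
  have card_ge: "real n - \<bar>of_int k\<bar> \<le> card (good n)" for n
  proof -
    \<comment> \<open>The two extra ranges hold the indices with i < k and with i >= n + k. At most
      one of them is nonempty, according to the sign of \<open>k\<close>, and together they have at
      most |k| elements.\<close>
    have "{..<n} \<subseteq> good n \<union> {..<nat k} \<union> {n - nat (- k)..<n}"
      by (auto simp: good_def)
    then have "card {..<n} \<le> card (good n \<union> {..<nat k} \<union> {n - nat (- k)..<n})"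
      by (intro card_mono) (auto simp: good_def)
    also have "\<dots> \<le> card (good n) + card {..<nat k} + card {n - nat (- k)..<n}"
      by (meson card_Un_le add_le_mono order_trans order_refl)
    finally show ?thesis by simp
  qed
  have "(\<lambda>n. real (card (good n)) / n) \<longlonglongrightarrow> 1"
  proof (rule tendsto_sandwich)
    show "\<forall>\<^sub>F n in sequentially. 1 - \<bar>of_int k\<bar> / real n \<le> card (good n) / n"
    proof (rule eventually_mono[OF eventually_gt_at_top[of 0]])
      show "1 - \<bar>of_int k\<bar> / real n \<le> card (good n) / n" if "n > 0" for n
        using divide_right_mono[OF card_ge[of n], of n] that by (simp add: diff_divide_distrib)
    qed
    show "\<forall>\<^sub>F n in sequentially. card (good n) / n \<le> (1::real)"
      by (rule eventually_mono[OF eventually_gt_at_top[of 0]]) (use card_le in simp)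
    have "(\<lambda>n. 1 - \<bar>of_int k\<bar> / real n) \<longlonglongrightarrow> 1 - 0"
      by (intro tendsto_intros lim_const_over_n)
    then show "(\<lambda>n. 1 - \<bar>of_int k\<bar> / real n) \<longlonglongrightarrow> 1" by simp
  qed simp
  from tendsto_scaleR[OF this tendsto_const[of ?x]] show ?thesis
    by (simp add: fej)
qed

text \<open>A three-epsilon argument: the uniform bound on the maps \<open>L n\<close> carries
  convergence from the span to its closure.\<close>

lemma linear_contractions_tendsto_closure_span:
  fixes L :: "nat \<Rightarrow> 'b::real_normed_vector \<Rightarrow> 'b"
  assumes lin: "\<And>n. linear (L n)" and contr: "\<And>n x. norm (L n x) \<le> norm x"
    and lim: "\<And>b. b \<in> B \<Longrightarrow> (\<lambda>n. L n b) \<longlonglongrightarrow> b" and x: "x \<in> closure (span B)"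
  shows "(\<lambda>n. L n x) \<longlonglongrightarrow> x"
proof (rule LIMSEQ_I)
  fix e :: real assume "0 < e"
  then obtain y where y: "y \<in> span B" "dist y x < e / 3"
    using x by (metis closure_approachable zero_less_divide_iff zero_less_numeral)
  have "(\<lambda>n. L n y) \<longlonglongrightarrow> y"
    using y(1)
  proof (induction rule: span_induct_alt)
    case base
    show ?case using lin by (simp add: linear_0)
  next
    case (step c b z)
    then show ?case
      by (simp add: linear_add[OF lin] linear_scale[OF lin] tendsto_add tendsto_scaleR lim)
  qed
  then obtain N where N: "\<And>n. n \<ge> N \<Longrightarrow> norm (L n y - y) < e / 3"
    using LIMSEQ_D[of _ y "e / 3"] \<open>0 < e\<close> by auto
  show "\<exists>N. \<forall>n\<ge>N. norm (L n x - x) < e"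
  proof (intro exI allI impI)
    fix n assume n: "n \<ge> N"
    have "L n x - x = L n (x - y) + (L n y - y) + (y - x)"
      by (simp add: linear_diff[OF lin])
    also have "norm \<dots> \<le> norm (L n (x - y)) + norm (L n y - y) + norm (y - x)"
      by (meson norm_triangle_le add_right_mono norm_triangle_ineq order_trans)
    also have "\<dots> < e"
      using contr[of n "x - y"] N[OF n] y(2) by (simp add: dist_norm norm_minus_commute)
    finally show "norm (L n x - x) < e" .
  qed
qed

theorem fejer_tendsto: "(\<lambda>n. fejer n x) \<longlonglongrightarrow> x"
proof (rule linear_contractions_tendsto_closure_span)
  show "linear (fejer n)" for n
    by (rule bounded_linear.linear[OF bounded_linear_fejer])
  show "x \<in> closure (span {scaleC c (monomial n) |c n. True})"
    using trig_span_dense unfolding trig_span_def by simp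
qed (auto simp: norm_fejer_le fejer_monomial_tendsto)

text \<open>Fejer means see only the Fourier coefficients, and they converge to the vector
  itself.\<close>

lemma circle_L2_eqI:
  assumes "\<And>k. cinner x (monomial k) = cinner y (monomial k)"
  shows "x = y"
proof -
  have "fejer n x = fejer n y" for n
    by (simp add: fejer_def trig_proj_def assms)
  then show ?thesis
    using fejer_tendsto[of x] fejer_tendsto[of y] by (simp add: LIMSEQ_unique)
qed

text \<open>This is the usual sum of (1 - |k|/n) c(k) z^k over |k| < n, kept as a double sum over k
  = i - j so that it reads as a quadratic form. Unlike a class in \<open>circle_L2\<close> it has a
  value at every \<open>z\<close>.\<close>

definition fejer_fun :: "nat \<Rightarrow> (int \<Rightarrow> complex) \<Rightarrow> complex \<Rightarrow> complex" where
  "fejer_fun n c z = (\<Sum>i<n. \<Sum>j<n. c (int i - int j) * z powi (int i - int j)) / n"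

lemma square_integrable_fejer_fun: "square_integrable (fejer_fun n c)"
proof -
  have "square_integrable (\<lambda>z. (1 / n) * (\<Sum>i<n. \<Sum>j<n. c (int i - int j) * z powi (int i - int j)))"
    by (intro square_integrable_scale square_integrable_sum square_integrable_powi)
  then show ?thesis by (simp add: fejer_fun_def[abs_def])
qed

text \<open>The substitution k = i - j carries the window (i - n, i] to 0 <= j < n.\<close>

lemma abs_fejer_fun: "abs_circle_L2 (fejer_fun n (\<lambda>k. cinner x (monomial k))) = fejer n x"
proof -
  let ?c = "\<lambda>k. cinner x (monomial k)"
  note sq = square_integrable_scale square_integrable_sum square_integrable_powi
  have "trig_proj {int i - int n<..int i} x =
      abs_circle_L2 (\<lambda>z. \<Sum>j<n. ?c (int i - int j) * z powi (int i - int j))" for i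
  proof -
    have "trig_proj {int i - int n<..int i} x =
        (\<Sum>j<n. scaleC (?c (int i - int j)) (monomial (int i - int j)))"
      unfolding trig_proj_def
      by (rule sum.reindex_bij_witness[of _ "\<lambda>j. int i - int j" "\<lambda>k. nat (int i - k)"]) auto
    also have "\<dots> = (\<Sum>j<n. abs_circle_L2 (\<lambda>z. ?c (int i - int j) * z powi (int i - int j)))"
      by (simp add: monomial_eq scaleC_abs_circle_L2 square_integrable_powi)
    finally show ?thesis by (simp add: abs_circle_L2_sum sq)
  qed
  then have "fejer n x = (1 / n) *\<^sub>R
      abs_circle_L2 (\<lambda>z. \<Sum>i<n. \<Sum>j<n. ?c (int i - int j) * z powi (int i - int j))"
    by (simp add: fejer_def abs_circle_L2_sum sq)
  then show ?thesis
    by (simp add: scaleR_circle_L2_def scaleC_abs_circle_L2 sq fejer_fun_def[abs_def])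
qed

lemma scaleC_bounded_clinear: "bounded_clinear T \<Longrightarrow> T (scaleC c x) = scaleC c (T x)"
  by (simp add: bounded_clinear_def)

text \<open>For a Toeplitz-type operator, $n$ times the Fejer mean of its symbol at \<open>z\<close> is the quadratic
  form of the operator at the vector $\sum_{j<n} z^{-j} e_j$, whose norm squared is \<open>n\<close>.\<close>

lemma norm_fejer_fun_le:
  assumes T: "bounded_clinear T"
    and c: "\<And>i j. cinner (T (monomial j)) (monomial i) = c (i - j)" and z: "norm z = 1"
  shows "norm (fejer_fun n c z) \<le> onorm T"
proof (cases "n = 0")
  case False
  have bl: "bounded_linear T" using T by (simp add: bounded_clinear_def)
  then have lin: "linear T" by (rule bounded_linear.linear)
  have z0: "z \<noteq> 0" using z by auto
  have cnj_z: "cnj z = inverse z"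
    using z by (rule cnj_eq_inverse)
  define u where "u = (\<Sum>j<n. scaleC (z powi (- int j)) (monomial (int j)))"
  have "cinner u u = of_nat n"
    unfolding u_def
    by (simp add: cinner_sum_left cinner_sum_right cinner_scaleC_left cinner_scaleC_right cnj_z
        cinner_monomial power_int_inverse z0 if_distrib cong: if_cong)
  then have norm_u: "(norm u)\<^sup>2 = n"
    by (metis cinner_self of_real_eq_iff of_real_of_nat_eq)
  have "cinner (T u) u = n * fejer_fun n c z"
  proof -
    have "T u = (\<Sum>j<n. scaleC (z powi (- int j)) (T (monomial (int j))))"
      by (simp add: u_def linear_sum[OF lin] scaleC_bounded_clinear[OF T])
    \<comment> \<open>On the circle the conjugate of z^(-i) is z^i, so the second argument
      contributes z^i and the first z^(-j).\<close>
    then have "cinner (T u) u = (\<Sum>i<n. \<Sum>j<n. z powi int i * (z powi (- int j) * c (int i - int j)))"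
      by (simp add: u_def cinner_sum_left cinner_sum_right cinner_scaleC_left cinner_scaleC_right c cnj_z
          power_int_inverse power_int_minus power_inverse sum_distrib_left)
    also have "\<dots> = (\<Sum>i<n. \<Sum>j<n. c (int i - int j) * z powi (int i - int j))"
      using z0 by (intro sum.cong refl) (simp add: power_int_diff power_int_minus divide_inverse)
    finally show ?thesis using False by (simp add: fejer_fun_def)
  qed
  then have "n * norm (fejer_fun n c z) = norm (cinner (T u) u)"
    by (simp add: norm_mult)
  also have "\<dots> \<le> norm (T u) * norm u"
    by (rule cinner_Cauchy_Schwarz)
  also have "\<dots> \<le> (onorm T * norm u) * norm u"
    by (intro mult_right_mono onorm[OF bl]) simp
  also have "\<dots> = n * onorm T"
    by (simp add: norm_u[symmetric] power2_eq_square)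
  finally show ?thesis using False by simp
qed (use T in \<open>simp add: fejer_fun_def onorm_pos_le bounded_clinear_def\<close>)

section \<open>Measurable symbols\<close>

text \<open>The integral of the series is the sum of the integrals, hence finite; so the series
  converges almost everywhere and its terms tend to 0.\<close>

lemma AE_tendsto_zero_if_summable_integral:
  fixes f :: "nat \<Rightarrow> 'b \<Rightarrow> real"
  assumes int: "\<And>k. integrable M (f k)" and nonneg: "\<And>k x. 0 \<le> f k x"
    and summ: "summable (\<lambda>k. LINT x|M. f k x)"
  shows "AE x in M. (\<lambda>k. f k x) \<longlonglongrightarrow> 0"
proof -
  note [measurable] = borel_measurable_integrable[OF int]
  have "(\<integral>\<^sup>+x. (\<Sum>k. ennreal (f k x)) \<partial>M) = (\<Sum>k. \<integral>\<^sup>+x. ennreal (f k x) \<partial>M)"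
    by (rule nn_integral_suminf) simp
  also have "\<dots> = (\<Sum>k. ennreal (LINT x|M. f k x))"
    by (intro arg_cong[where f=suminf] ext nn_integral_eq_integral int) (simp add: nonneg)
  also have "\<dots> \<noteq> \<infinity>"
    using summ nonneg by (simp add: suminf_ennreal2)
  finally have "AE x in M. (\<Sum>k. ennreal (f k x)) \<noteq> \<infinity>"
    by (intro nn_integral_PInf_AE) auto
  then show ?thesis
  proof eventually_elim
    case (elim x)
    then have "summable (\<lambda>k. f k x)"
      using nonneg by (intro summable_suminf_not_top) auto
    then show ?case by (rule summable_LIMSEQ_zero)
  qed
qed

text \<open>Almost everywhere convergence of a subsequence of an $L^2$ convergent sequence, with the
  subsequence chosen measurably in the parameter \<open>\<omega>\<close>.\<close>

lemma measurable_L2_limit: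
  fixes s :: "nat \<Rightarrow> 'a \<times> complex \<Rightarrow> complex"
  assumes s [measurable]: "\<And>n. s n \<in> borel_measurable (M \<Otimes>\<^sub>M circle_measure)"
    and sq: "\<And>\<omega> n. \<omega> \<in> space M \<Longrightarrow> square_integrable (\<lambda>z. s n (\<omega>, z))"
    and g: "\<And>\<omega>. \<omega> \<in> space M \<Longrightarrow> square_integrable (g \<omega>)"
    and lim: "\<And>\<omega>. \<omega> \<in> space M \<Longrightarrow>
      (\<lambda>n. abs_circle_L2 (\<lambda>z. s n (\<omega>, z))) \<longlonglongrightarrow> abs_circle_L2 (g \<omega>)"
    and bound: "\<And>\<omega> n z. \<omega> \<in> space M \<Longrightarrow> norm z = 1 \<Longrightarrow> norm (s n (\<omega>, z)) \<le> C \<omega>"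
  obtains \<phi> where "\<phi> \<in> borel_measurable (M \<Otimes>\<^sub>M circle_measure)"
    "\<And>\<omega>. \<omega> \<in> space M \<Longrightarrow> bounded ((\<lambda>z. \<phi> (\<omega>, z)) ` sphere 0 1)"
    "\<And>\<omega>. \<omega> \<in> space M \<Longrightarrow> AE z in circle_measure. \<phi> (\<omega>, z) = g \<omega> z"
proof -
  interpret prob_space circle_measure by (rule prob_space_circle_measure)
  \<comment> \<open>Distances are taken within the sequence and not to \<open>g\<close>: nothing is
    assumed about how \<open>g \<omega>\<close> varies with \<omega>, whereas the integrals
    \<open>D m n\<close> are measurable in it.\<close>
  define D where "D m n \<omega> = (LINT z|circle_measure. (norm (s m (\<omega>, z) - s n (\<omega>, z)))\<^sup>2)" for m n \<omega>
  \<comment> \<open>From this index on the terms stay within L^2 distance 2^(-k) of the selected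
    one; the squares 4^(-k) are summable, which gives almost everywhere convergence.\<close>
  define N where "N k \<omega> = (LEAST n. \<forall>m\<ge>n. D m n \<omega> \<le> (1 / 4) ^ k)" for k \<omega>
  define t where "t k p = s (N k (fst p)) p" for k p
  \<comment> \<open>The Cauchy test refers to \<open>t\<close> alone, so the set of convergence is
    jointly measurable; the value 0 off it keeps the function measurable and bounded at every
    point.\<close>
  define \<phi> where "\<phi> p = (if Cauchy (\<lambda>k. t k p) then lim (\<lambda>k. t k p) else 0)" for p
  have D_meas [measurable]: "D m n \<in> borel_measurable M" for m n
    unfolding D_def by measurable
  have N_meas [measurable]: "N k \<in> measurable M (count_space UNIV)" for k
    unfolding N_def by measurable
  have t_meas [measurable]: "t k \<in> borel_measurable (M \<Otimes>\<^sub>M circle_measure)" for k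
    unfolding t_def
    \<comment> \<open>\<open>N k\<close> has countably many values, and where it equals
      \<open>n\<close> the function \<open>t k\<close> coincides with \<open>s n\<close>.\<close>
    by (rule measurable_compose_countable[where f = s]) measurable
  have \<phi>_meas: "\<phi> \<in> borel_measurable (M \<Otimes>\<^sub>M circle_measure)"
    unfolding \<phi>_def by measurable
  have D_norm: "D m n \<omega> = (norm (abs_circle_L2 (\<lambda>z. s m (\<omega>, z)) - abs_circle_L2 (\<lambda>z. s n (\<omega>, z))))\<^sup>2"
    if "\<omega> \<in> space M" for m n \<omega>
    using sq[OF that] by (simp add: D_def abs_circle_L2_diff norm_abs_circle_L2 square_integrable_diff)
  have close: "(LINT z|circle_measure. (norm (t k (\<omega>, z) - g \<omega> z))\<^sup>2) \<le> (1 / 4) ^ k"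
    if w: "\<omega> \<in> space M" for k \<omega>
  proof -
    define X where "X n = abs_circle_L2 (\<lambda>z. s n (\<omega>, z))" for n
    have "Cauchy X"
      using lim[OF w] unfolding X_def by (rule LIMSEQ_imp_Cauchy)
    then obtain n where n: "\<And>m. m \<ge> n \<Longrightarrow> norm (X m - X n) < (1 / 2) ^ k"
      using CauchyD[of X "(1 / 2) ^ k"] by auto
    have "(norm (X m - X n))\<^sup>2 \<le> (1 / 4) ^ k" if "m \<ge> n" for m
    proof -
      have "(norm (X m - X n))\<^sup>2 \<le> ((1 / 2) ^ k)\<^sup>2"
        using n[OF that] by (intro power_mono) auto
      then show ?thesis
        by (simp add: power2_eq_square flip: power_mult_distrib)
    qed
    then have "\<forall>m\<ge>n. D m n \<omega> \<le> (1 / 4) ^ k"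
      by (simp add: D_norm[OF w] X_def)
    then have "\<forall>m\<ge>N k \<omega>. D m (N k \<omega>) \<omega> \<le> (1 / 4) ^ k"
      unfolding N_def by (rule LeastI)
    then have N: "\<forall>m\<ge>N k \<omega>. (norm (X m - X (N k \<omega>)))\<^sup>2 \<le> (1 / 4) ^ k"
      by (simp add: D_norm[OF w] X_def)
    \<comment> \<open>Letting \<open>m\<close> tend to infinity replaces the later terms by the
      limit, so the internal estimate becomes one for the distance to
      \<open>g \<omega>\<close>.\<close>
    have "(\<lambda>m. (norm (X m - X (N k \<omega>)))\<^sup>2) \<longlonglongrightarrow> (norm (abs_circle_L2 (g \<omega>) - X (N k \<omega>)))\<^sup>2"
      unfolding X_def by (intro tendsto_intros lim w)
    then have "(norm (abs_circle_L2 (g \<omega>) - X (N k \<omega>)))\<^sup>2 \<le> (1 / 4) ^ k"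
      using N by (intro LIMSEQ_le_const2) auto
    then show ?thesis
      using sq[OF w] g[OF w]
      by (simp add: X_def abs_circle_L2_diff norm_abs_circle_L2 square_integrable_diff t_def
          norm_minus_commute)
  qed
  have t_lim: "AE z in circle_measure. (\<lambda>k. t k (\<omega>, z)) \<longlonglongrightarrow> g \<omega> z" if w: "\<omega> \<in> space M" for \<omega>
  proof -
    have "AE z in circle_measure. (\<lambda>k. (norm (t k (\<omega>, z) - g \<omega> z))\<^sup>2) \<longlonglongrightarrow> 0"
    proof (rule AE_tendsto_zero_if_summable_integral)
      show "integrable circle_measure (\<lambda>z. (norm (t k (\<omega>, z) - g \<omega> z))\<^sup>2)" for k
        using square_integrable_diff[OF sq[OF w] g[OF w]]
        by (simp add: t_def square_integrable_def)
      show "summable (\<lambda>k. LINT z|circle_measure. (norm (t k (\<omega>, z) - g \<omega> z))\<^sup>2)"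
        by (rule summable_comparison_test'[of "\<lambda>k. (1 / 4) ^ k" 0])
          (use close[OF w] in \<open>simp_all add: summable_geometric\<close>)
    qed simp
    then show ?thesis
    proof eventually_elim
      case (elim z)
      from tendsto_real_sqrt[OF this] have "(\<lambda>k. norm (t k (\<omega>, z) - g \<omega> z)) \<longlonglongrightarrow> 0" by simp
      then show ?case by (simp add: tendsto_norm_zero_iff LIM_zero_cancel)
    qed
  qed
  show thesis
  proof (rule that[OF \<phi>_meas])
    fix \<omega> assume w: "\<omega> \<in> space M"
    show "bounded ((\<lambda>z. \<phi> (\<omega>, z)) ` sphere 0 1)"
    proof (rule boundedI)
      fix y assume "y \<in> (\<lambda>z. \<phi> (\<omega>, z)) ` sphere 0 1"
      then obtain z where z: "norm z = 1" "y = \<phi> (\<omega>, z)" by auto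
      show "norm y \<le> \<bar>C \<omega>\<bar>"
      proof (cases "Cauchy (\<lambda>k. t k (\<omega>, z))")
        case True
        then have "(\<lambda>k. t k (\<omega>, z)) \<longlonglongrightarrow> y"
          by (simp add: z(2) \<phi>_def Cauchy_convergent flip: convergent_LIMSEQ_iff)
        then have "(\<lambda>k. norm (t k (\<omega>, z))) \<longlonglongrightarrow> norm y"
          by (rule tendsto_norm)
        moreover have "norm (t k (\<omega>, z)) \<le> \<bar>C \<omega>\<bar>" for k
          unfolding t_def using bound[OF w z(1), of "N k \<omega>"] by simp
        ultimately show ?thesis
          by (intro LIMSEQ_le_const2) auto
      qed (simp add: z(2) \<phi>_def)
    qed
    show "AE z in circle_measure. \<phi> (\<omega>, z) = g \<omega> z"
      using t_lim[OF w]
      by eventually_elim (simp add: \<phi>_def LIMSEQ_imp_Cauchy limI)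
  qed
qed

section \<open>Multiplication operators and their matrices\<close>

lemma mult_operator_abs_circle_L2:
  assumes "g \<in> borel_measurable circle_measure" "bounded (g ` sphere 0 1)" "square_integrable f"
  shows "mult_operator g (abs_circle_L2 f) = abs_circle_L2 (\<lambda>z. g z * f z)"
  using mult_operator.abs_eq[of f g] assms by (simp add: ae_eq_refl_iff)

lemma bounded_clinear_mult_operator:
  assumes g: "g \<in> borel_measurable circle_measure" "bounded (g ` sphere 0 1)"
  shows "bounded_clinear (mult_operator g)"
proof -
  note sq = square_integrable_bounded_mult[OF _ g]
  note mult = mult_operator_abs_circle_L2[OF g]
  have add: "mult_operator g (x + y) = mult_operator g x + mult_operator g y" for x y
  proof -
    obtain f h where "square_integrable f" "x = abs_circle_L2 f" "square_integrable h" "y = abs_circle_L2 h"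
      by (metis circle_L2_cases)
    then show ?thesis
      by (simp add: abs_circle_L2_add mult square_integrable_add sq distrib_left)
  qed
  have scale: "mult_operator g (scaleC c x) = scaleC c (mult_operator g x)" for c x
  proof -
    obtain f where "square_integrable f" "x = abs_circle_L2 f"
      by (metis circle_L2_cases)
    then show ?thesis
      by (simp add: scaleC_abs_circle_L2 mult square_integrable_scale sq mult.left_commute)
  qed
  obtain C where "\<forall>y\<in>g ` sphere 0 1. norm y \<le> C"
    using g(2) unfolding bounded_iff by blast
  then have C: "norm (g z) \<le> C" if "norm z = 1" for z
    using that by simp
  have "norm (mult_operator g x) \<le> norm x * C" for x
  proof -
    obtain f where f: "square_integrable f" "x = abs_circle_L2 f"
      by (metis circle_L2_cases)
    have "0 \<le> C" by (rule order_trans[OF norm_ge_zero C[of 1]]) simp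
    have "(norm (mult_operator g x))\<^sup>2 = (LINT z|circle_measure. (norm (g z * f z))\<^sup>2)"
      by (simp add: f mult norm_abs_circle_L2 sq)
    also have "\<dots> \<le> (LINT z|circle_measure. C\<^sup>2 * (norm (f z))\<^sup>2)"
    proof (rule integral_mono)
      show "integrable circle_measure (\<lambda>z. (norm (g z * f z))\<^sup>2)"
        using sq[OF f(1)] by (simp add: square_integrable_def)
      show "integrable circle_measure (\<lambda>z. C\<^sup>2 * (norm (f z))\<^sup>2)"
        using f(1) by (simp add: square_integrable_def)
      show "(norm (g z * f z))\<^sup>2 \<le> C\<^sup>2 * (norm (f z))\<^sup>2" if "z \<in> space circle_measure" for z
        using C[of z] that by (simp add: norm_mult power_mult_distrib mult_right_mono power_mono)
    qed
    also have "\<dots> = (norm x * C)\<^sup>2"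
      by (simp add: f norm_abs_circle_L2 power_mult_distrib mult.commute)
    finally show ?thesis
      by (rule power2_le_imp_le) (simp add: \<open>0 \<le> C\<close>)
  qed
  then have "bounded_linear (mult_operator g)"
    by (intro bounded_linear_intro[where K=C]) (simp_all add: add scale scaleR_circle_L2_def)
  then show ?thesis by (simp add: bounded_clinear_def scale)
qed

text \<open>On the circle z^j times the conjugate of z^i is the conjugate of z^(i-j). If
  \<open>g\<close> is not bounded and measurable, the dummy value makes the operator zero and both
  sides vanish, so the identity holds for every \<open>g\<close>.\<close>

lemma cinner_mult_operator_monomial:
  "cinner (mult_operator g (monomial j)) (monomial i) =
    cinner (mult_operator g (monomial 0)) (monomial (i - j))"
proof (cases "g \<in> borel_measurable circle_measure \<and> bounded (g ` sphere 0 1)")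
  case True
  then have "cinner (mult_operator g (monomial j)) (monomial i) =
      (LINT z|circle_measure. g z * z powi j * cnj (z powi i))" for i j
    by (simp add: monomial_eq mult_operator_abs_circle_L2 square_integrable_powi
        cinner_abs_circle_L2 square_integrable_bounded_mult)
  moreover have "(LINT z|circle_measure. g z * z powi j * cnj (z powi i)) =
      (LINT z|circle_measure. g z * z powi 0 * cnj (z powi (i - j)))"
  proof (intro Bochner_Integration.integral_cong refl)
    fix z assume "z \<in> space circle_measure"
    then have z: "norm z = 1" "z \<noteq> 0" by auto
    then have "cnj z = inverse z"
      by (simp only: cnj_eq_inverse)
    then show "g z * z powi j * cnj (z powi i) = g z * z powi 0 * cnj (z powi (i - j))"
      using z by (simp add: power_int_inverse power_int_diff divide_inverse)
  qed
  ultimately show ?thesis by simp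
next
  case False
  have "mult_operator g x = 0" for x
  proof -
    obtain f where "square_integrable f" "x = abs_circle_L2 f"
      by (rule circle_L2_cases)
    then show ?thesis
      using mult_operator.abs_eq[of f g] False by (auto simp: ae_eq_refl_iff zero_circle_L2_def)
  qed
  then show ?thesis by (simp add: cinner_zero_left)
qed

lemma toeplitz_coeff:
  fixes a :: "int \<Rightarrow> int \<Rightarrow> 'b"
  assumes "\<And>i j. a (i + 1) (j + 1) = a i j"
  shows "a i j = a (i - j) 0"
proof -
  have shift: "a (i + int k) (j + int k) = a i j" for i j k
  proof (induction k)
    case (Suc k)
    then show ?case using assms[of "i + int k" "j + int k"] by (simp add: algebra_simps)
  qed simp
  show ?thesis
    \<comment> \<open>For j >= 0 move (i - j, 0) up the diagonal to (i, j); for j < 0 move (i, j) up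
      to (i - j, 0).\<close>
    using shift[of "i - j" "nat j" 0] shift[of i "nat (- j)" j] by (cases "j \<ge> 0") simp_all
qed

text \<open>By complex linearity the operators agree on the generators of \<open>trig_span\<close>;
  the set where they agree is closed by continuity, and the span is dense.\<close>

lemma bounded_clinear_eqI:
  assumes T: "bounded_clinear T" and G: "bounded_clinear G"
    and eq: "\<And>n. T (monomial n) = G (monomial n)"
  shows "T = G"
proof -
  have bl: "bounded_linear T" "bounded_linear G"
    using T G by (simp_all add: bounded_clinear_def)
  have "trig_span \<subseteq> {x. T x = G x}"
  proof
    fix x assume "x \<in> trig_span"
    then have "T x = G x"
      unfolding trig_span_def
      by (rule linear_eq_on_span[OF bl[THEN bounded_linear.linear], rotated])
        (auto simp: scaleC_bounded_clinear[OF T] scaleC_bounded_clinear[OF G] eq)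
    then show "x \<in> {x. T x = G x}" by simp
  qed
  then have "closure trig_span \<subseteq> {x. T x = G x}"
    by (intro closure_minimal closed_Collect_eq linear_continuous_on bl)
  then show ?thesis using trig_span_dense by auto
qed

section \<open>Laurent operators and constancy along diagonals\<close>

theorem theorem16:
  fixes M :: "'a measure" and A :: "'a \<Rightarrow> circle_L2 \<Rightarrow> circle_L2"
  assumes "prob_space M" and "random_operator M A"
  shows "laurent_random_operator M A \<longleftrightarrow>
    (\<forall>\<omega>\<in>space M. \<forall>i j :: int. matrix_coeff A (i + 1) (j + 1) \<omega> = matrix_coeff A i j \<omega>)"
proof
  assume "laurent_random_operator M A"
  then obtain \<phi> where A: "\<And>\<omega>. \<omega> \<in> space M \<Longrightarrow> A \<omega> = mult_operator (\<lambda>z. \<phi> (\<omega>, z))"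
    by (auto simp: laurent_random_operator_def)
  show "\<forall>\<omega>\<in>space M. \<forall>i j :: int. matrix_coeff A (i + 1) (j + 1) \<omega> = matrix_coeff A i j \<omega>"
  proof (intro ballI allI)
    fix \<omega> i j
    assume "\<omega> \<in> space M"
    then show "matrix_coeff A (i + 1) (j + 1) \<omega> = matrix_coeff A i j \<omega>"
      using cinner_mult_operator_monomial[of _ "j + 1" "i + 1"] cinner_mult_operator_monomial[of _ j i]
      by (simp add: matrix_coeff_def A)
  qed
next
  assume shift: "\<forall>\<omega>\<in>space M. \<forall>i j :: int. matrix_coeff A (i + 1) (j + 1) \<omega> = matrix_coeff A i j \<omega>"
  define c where "c \<omega> k = cinner (A \<omega> (monomial 0)) (monomial k)" for \<omega> k
  have A: "bounded_clinear (A \<omega>)" if "\<omega> \<in> space M" for \<omega>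
    using assms(2) that by (simp add: random_operator_def)
  have c_meas [measurable]: "(\<lambda>\<omega>. c \<omega> k) \<in> borel_measurable M" for k
    using assms(2) by (simp add: random_operator_def c_def)
  have powi_meas [measurable]: "(\<lambda>z. z powi k) \<in> borel_measurable circle_measure" for k
    by (rule square_integrable_measurable[OF square_integrable_powi])
  have coeff: "cinner (A \<omega> (monomial j)) (monomial i) = c \<omega> (i - j)" if "\<omega> \<in> space M" for \<omega> i j
    using toeplitz_coeff[of "\<lambda>i j. matrix_coeff A i j \<omega>" i j] shift that
    by (simp add: matrix_coeff_def c_def)
  define s where "s n p = fejer_fun n (c (fst p)) (snd p)" for n p
  \<comment> \<open>Chosen for each \<omega> on its own, with no control of the dependence on
    \<omega>; it only names the almost everywhere limit that identifies \<phi>.\<close>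
  define g where "g \<omega> = (SOME f. square_integrable f \<and> abs_circle_L2 f = A \<omega> (monomial 0))" for \<omega>
  have g: "square_integrable (g \<omega>)" "abs_circle_L2 (g \<omega>) = A \<omega> (monomial 0)" for \<omega>
  proof -
    have "\<exists>f. square_integrable f \<and> abs_circle_L2 f = A \<omega> (monomial 0)"
      by (metis circle_L2_cases)
    from someI_ex[OF this] show "square_integrable (g \<omega>)" "abs_circle_L2 (g \<omega>) = A \<omega> (monomial 0)"
      unfolding g_def by auto
  qed
  obtain \<phi> where \<phi>: "\<phi> \<in> borel_measurable (M \<Otimes>\<^sub>M circle_measure)"
    "\<And>\<omega>. \<omega> \<in> space M \<Longrightarrow> bounded ((\<lambda>z. \<phi> (\<omega>, z)) ` sphere 0 1)"
    "\<And>\<omega>. \<omega> \<in> space M \<Longrightarrow> AE z in circle_measure. \<phi> (\<omega>, z) = g \<omega> z"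
  proof (rule measurable_L2_limit[of s M g "\<lambda>\<omega>. onorm (A \<omega>)"])
    show "s n \<in> borel_measurable (M \<Otimes>\<^sub>M circle_measure)" for n
      unfolding s_def fejer_fun_def by measurable
    fix \<omega> assume w: "\<omega> \<in> space M"
    show "square_integrable (\<lambda>z. s n (\<omega>, z))" for n
      by (simp add: s_def square_integrable_fejer_fun)
    have "abs_circle_L2 (\<lambda>z. s n (\<omega>, z)) = fejer n (A \<omega> (monomial 0))" for n
      using abs_fejer_fun[of n "A \<omega> (monomial 0)"] by (simp add: s_def c_def[abs_def])
    then show "(\<lambda>n. abs_circle_L2 (\<lambda>z. s n (\<omega>, z))) \<longlonglongrightarrow> abs_circle_L2 (g \<omega>)"
      by (simp add: g fejer_tendsto)
    show "norm (s n (\<omega>, z)) \<le> onorm (A \<omega>)" if "norm z = 1" for n z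
      using norm_fejer_fun_le[OF A[OF w] coeff[OF w] that] by (simp add: s_def)
  qed (use g in auto)
  have "A \<omega> = mult_operator (\<lambda>z. \<phi> (\<omega>, z))" if w: "\<omega> \<in> space M" for \<omega>
  proof (rule bounded_clinear_eqI[OF A[OF w]])
    have meas: "(\<lambda>z. \<phi> (\<omega>, z)) \<in> borel_measurable circle_measure"
      using \<phi>(1) w by (rule measurable_Pair2)
    note \<phi>w = meas \<phi>(2)[OF w]
    show "bounded_clinear (mult_operator (\<lambda>z. \<phi> (\<omega>, z)))"
      using \<phi>w by (rule bounded_clinear_mult_operator)
    have "mult_operator (\<lambda>z. \<phi> (\<omega>, z)) (monomial 0) = abs_circle_L2 (\<lambda>z. \<phi> (\<omega>, z) * z powi 0)"
      unfolding monomial_eq by (rule mult_operator_abs_circle_L2[OF \<phi>w square_integrable_powi])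
    also have "\<dots> = abs_circle_L2 (g \<omega>)"
    proof (rule abs_circle_L2_eq_iff[THEN iffD2])
      show "AE z in circle_measure. \<phi> (\<omega>, z) * z powi 0 = g \<omega> z"
        using \<phi>(3)[OF w] by simp
    qed (rule square_integrable_bounded_mult[OF square_integrable_powi \<phi>w] g(1))+
    finally have zero: "mult_operator (\<lambda>z. \<phi> (\<omega>, z)) (monomial 0) = A \<omega> (monomial 0)"
      by (simp add: g)
    \<comment> \<open>Both matrices are constant along diagonals, so agreement of the columns of e_0
      spreads to all columns.\<close>
    show "A \<omega> (monomial n) = mult_operator (\<lambda>z. \<phi> (\<omega>, z)) (monomial n)" for n
    proof (rule circle_L2_eqI)
      fix k
      show "cinner (A \<omega> (monomial n)) (monomial k) =
          cinner (mult_operator (\<lambda>z. \<phi> (\<omega>, z)) (monomial n)) (monomial k)"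
        by (subst cinner_mult_operator_monomial) (simp add: zero coeff[OF w])
    qed
  qed
  then show "laurent_random_operator M A"
    unfolding laurent_random_operator_def using \<phi>(1,2) by blast
qed

end
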